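(* Let $\{z^k:=(x^k,y^k)\}$ be generated by the LIPAL algorithm (defined in the context) with $\tau\in(0,1]$, $\rho>0$, $\beta>0$, and let $P(\cdot)$ and $\{\mathcal P_k\}_{k\ge1}$ be the Lyapunov function and its values (defined in the context). Suppose that $\{x^k\}$ belongs to a compact set $\mathcal S$ on which Assumption 2 holds, that $\beta\ge\max\{2L^\tau_\rho,\ 8(1-\tau)\rho M_F^2/\tau^2\}$, and additionally that $P(\cdot)$ satisfies the KL property on $\Omega$, the set of limit points of $\{u^k\}_{k\ge1}$. Then $$\sum_{k=0}^\infty\big(\|\Delta x^k\|+\|\Delta y^k\|\big)<\infty\quad\text{and}\quad\lim_{k\to\infty}z^k=z^*=:(x^*,y^* ),$$ and $(x^*,y^* )$ is an $\epsilon$-first-order optimal solution of the problem with $\epsilon:=\frac\tau\rho\|y^*-y^0\|$.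
   Context: **Problem.** Minimize $f(x)+g(x)$ over $x\in\mathbb R^n$ subject to $F(x)=0$, where $f:\mathbb R^n\to\mathbb R$ and $F:\mathbb R^n\to\mathbb R^m$ are smooth (possibly nonconvex/nonlinear) and $g:\mathbb R^n\to[-\infty,\infty]$ is proper and lower semicontinuous. $J_F(x)\in\mathbb R^{m\times n}$ is the Jacobian of $F$. **Subdifferentials.** For $C\subset\mathbb R^n$, $\bar x\in C$: $\widehat N_C(\bar x)=\{v:\limsup_{x\to\bar x,\,x\in C,\,x\ne\bar x}\langle v,x-\bar x\rangle/\|x-\bar x\|\le0\}$, and $N^{\lim}_C(\bar x)$ is the set of limits of $v_k\in\widehat N_C(x^k)$ with $x^k\to\bar x$, $x^k\in C$. For an extended-real-valued function $h$: $\partial h(x)=\{v:(v,-1)\in N^{\lim}_{\operatorname{epi}h}(x,h(x))\}$ and $\partial^\infty h(x)=\{v:(v,0)\in N^{\lim}_{\operatorname{epi}h}(x,h(x))\}$; both are empty if $|h(x)|=\infty$. The distance to the empty set is $+\infty$. **Assumption 2 on a compact set $\mathcal S$.** There are positive constants $M_f,M_F,L_f,L_F,\sigma$ such that for all $x,y\in\mathcal S$: (i) $\|\nabla f(x)\|\le M_f$, $\|\nabla f(x)-\nabla f(y)\|\le L_f\|x-y\|$; (ii) $\|J_F(x)\|\le M_F$, $\|J_F(x)-J_F(y)\|\le L_F\|x-y\|$; (iii) $\sigma\|F(x)\|\le\operatorname{dist}(-J_F(x)^TF(x),\partial^\infty g(x))$. **LIPAL algorithm.** Given $x^0\in\operatorname{dom}g$,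 $y^0\in\mathbb R^m$, $\tau\in(0,1]$, $\rho>0$, $\beta>0$; for $k=0,1,2,\dots$ put $y^k_\tau:=\tau y^0+(1-\tau)y^k$, $$x^{k+1}\in\arg\min_{x\in\mathbb R^n}\Big\{\ell_f(x;x^k)+g(x)+\langle y^k_\tau,\ell_F(x;x^k)\rangle+\tfrac\rho2\|\ell_F(x;x^k)\|^2+\tfrac\beta2\|x-x^k\|^2\Big\},\qquad y^{k+1}=y^k_\tau+\rho F(x^{k+1}),$$ with $\ell_f(x;\bar x)=f(\bar x)+\langle\nabla f(\bar x),x-\bar x\rangle$, $\ell_F(x;\bar x)=F(\bar x)+J_F(\bar x)(x-\bar x)$. Notation: $\Delta x^k:=x^{k+1}-x^k$, $\Delta y^k:=y^{k+1}-y^k$. **Constant.** With $\Delta:=\sup_{x\in\mathcal S}\|F(x)\|$, $R:=\|y^0\|+\frac\rho\tau\Delta$ and $\mathbb B_R\subset\mathbb R^m$ the ball of radius $R$ centered at $0$: $L^\tau_\rho:=L_f+L_F\sup_{(x,y)\in\mathcal S\times\mathbb B_R}\|\tau y^0+(1-\tau)y+\rho F(x)\|+\rho M_F^2$. **Lyapunov function.** $\mathcal L^\tau_\rho(x,y;y^0):=f(x)+g(x)+\langle\tau y^0+(1-\tau)y,F(x)\rangle+\frac\rho2\|F(x)\|^2$, $$P(x,y,y';y^0):=\mathcal L^\tau_\rho(x,y;y^0)-\frac{\tau(1-\tau)}{2\rho}\|y-y^0\|^2+\frac{2(1-\tau)^2}{\tau\rho}\|y-y'\|^2,$$ viewed as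 a function of $(x,y,y')$ with $y^0$ fixed; $u^k:=(x^k,y^k,y^{k-1})$ and $\mathcal P_k:=P(x^k,y^k,y^{k-1};y^0)$ for $k\ge1$. **KL property.** For $\varepsilon\in(0,+\infty]$, $\Psi_\varepsilon$ is the set of continuous concave $\varphi:[0,\varepsilon]\to[0,+\infty)$ with $\varphi(0)=0$, continuously differentiable on $(0,\varepsilon)$ with $\varphi'>0$ there. A proper lower semicontinuous function $\Phi$ that is constant on $\Omega$ satisfies the KL property on $\Omega$ if there are $\epsilon>0$, $\varepsilon>0$ and $\varphi\in\Psi_\varepsilon$ such that for every $u^*\in\Omega$ and every $u$ with $\operatorname{dist}(u,\Omega)<\epsilon$ and $\Phi(u^* )<\Phi(u)<\Phi(u^* )+\varepsilon$ one has $\varphi'(\Phi(u)-\Phi(u^* ))\operatorname{dist}(0,\partial\Phi(u))\ge1$. **$\epsilon$-first-order optimal solution.** $(x^*,y^* )$ is such a solution if $\operatorname{dist}(-\nabla f(x^* )-J_F(x^* )^Ty^*,\partial g(x^* ))\le\epsilon$ and $\|F(x^* )\|\le\epsilon$.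
   Formalization: The formal theorem additionally assumes that each segment from x^k to x^{k+1} lies in S (automatic for convex S); for an arbitrary compact S the claim is false, since the iterates can cycle through finitely many points of S. *)

theory Defs
  imports "HOL-Analysis.Analysis"
begin

section \<open>Variational analysis\<close>

(* Unlike infdist, this distance to the empty set is infinite. *)
definition set_dist :: "'a::metric_space \<Rightarrow> 'a set \<Rightarrow> ereal" where
  "set_dist x A = (INF a\<in>A. ereal (dist x a))"

definition proper_fun :: "('a \<Rightarrow> ereal) \<Rightarrow> bool" where
  "proper_fun h \<longleftrightarrow> (\<forall>x. h x \<noteq> -\<infinity>) \<and> (\<exists>x. h x \<noteq> \<infinity>)"

definition lsc :: "('a::topological_space \<Rightarrow> ereal) \<Rightarrow> bool" where
  "lsc h \<longleftrightarrow> (\<forall>x. h x \<le> Liminf (at x) h)"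

definition edom :: "('a \<Rightarrow> ereal) \<Rightarrow> 'a set" where
  "edom h = {x. h x < \<infinity>}"

definition epi :: "('a \<Rightarrow> ereal) \<Rightarrow> ('a \<times> real) set" where
  "epi h = {(x, a). h x \<le> ereal a}"

(* Meant for x in C. If x is isolated in C the Limsup is -\<infinity>, so every v is normal. *)
definition regular_normal_cone :: "'a::real_inner set \<Rightarrow> 'a \<Rightarrow> 'a set" where
  "regular_normal_cone C x =
     {v. Limsup (at x within C) (\<lambda>z. ereal (inner v (z - x) / norm (z - x))) \<le> 0}"

definition limiting_normal_cone :: "'a::real_inner set \<Rightarrow> 'a \<Rightarrow> 'a set" where
  "limiting_normal_cone C x =
     {v. \<exists>xs vs. (\<forall>k. xs k \<in> C \<and> vs k \<in> regular_normal_cone C (xs k))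
                \<and> xs \<longlonglongrightarrow> x \<and> vs \<longlonglongrightarrow> v}"

definition limiting_subdiff :: "('a::real_inner \<Rightarrow> ereal) \<Rightarrow> 'a \<Rightarrow> 'a set" where
  "limiting_subdiff h x =
     (if \<bar>h x\<bar> = \<infinity> then {}
      else {v. (v, -1) \<in> limiting_normal_cone (epi h) (x, real_of_ereal (h x))})"

definition horizon_subdiff :: "('a::real_inner \<Rightarrow> ereal) \<Rightarrow> 'a \<Rightarrow> 'a set" where
  "horizon_subdiff h x =
     (if \<bar>h x\<bar> = \<infinity> then {}
      else {v. (v, 0) \<in> limiting_normal_cone (epi h) (x, real_of_ereal (h x))})"

definition limit_points :: "(nat \<Rightarrow> 'a::topological_space) \<Rightarrow> 'a set" where
  "limit_points u = {l. \<exists>r. strict_mono r \<and> (u \<circ> r) \<longlonglongrightarrow> l}"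

section \<open>The Kurdyka-Lojasiewicz property\<close>

(* The argument is real, so for \<eta> = \<infinity> the domain is [0, \<infinity>). *)
definition desingularizing :: "ereal \<Rightarrow> (real \<Rightarrow> real) \<Rightarrow> bool" where
  "desingularizing \<eta> \<phi> \<longleftrightarrow>
     (let D = {t. 0 \<le> t \<and> ereal t \<le> \<eta>}; I = {t. 0 < t \<and> ereal t < \<eta>} in
        continuous_on D \<phi> \<and> concave_on D \<phi> \<and> (\<forall>t\<in>D. 0 \<le> \<phi> t) \<and> \<phi> 0 = 0 \<and>
        (\<forall>t\<in>I. \<phi> differentiable (at t) \<and> 0 < deriv \<phi> t) \<and> continuous_on I (deriv \<phi>))"

definition KL_on :: "('a::real_inner \<Rightarrow> ereal) \<Rightarrow> 'a set \<Rightarrow> bool" where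
  "KL_on \<Phi> \<Omega> \<longleftrightarrow>
     proper_fun \<Phi> \<and> lsc \<Phi> \<and> \<Phi> constant_on \<Omega> \<and>
     (\<exists>\<epsilon>::real. \<exists>\<eta>::ereal. \<exists>\<phi>. 0 < \<epsilon> \<and> 0 < \<eta> \<and> desingularizing \<eta> \<phi> \<and>
        (\<forall>v\<in>\<Omega>. \<forall>u. set_dist u \<Omega> < ereal \<epsilon> \<and> \<Phi> v < \<Phi> u \<and> \<Phi> u < \<Phi> v + \<eta> \<longrightarrow>
           1 \<le> ereal (deriv \<phi> (real_of_ereal (\<Phi> u - \<Phi> v))) * set_dist 0 (limiting_subdiff \<Phi> u)))"

section \<open>The problem and the standing assumption\<close>

definition gradient :: "('a::real_inner \<Rightarrow> real) \<Rightarrow> 'a \<Rightarrow> 'a" where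
  "gradient f x = (THE D. GDERIV f x :> D)"

abbreviation Jac :: "(real^'n \<Rightarrow> real^'m) \<Rightarrow> real^'n \<Rightarrow> real^'n^'m" where
  "Jac F x \<equiv> jacobian F (at x)"

(* The norm of the type real^'n^'m is the Frobenius norm; this is the spectral norm. *)
definition opnorm :: "real^'n^'m \<Rightarrow> real" where
  "opnorm A = onorm (\<lambda>v. A *v v)"

definition smooth_fun :: "(real^'n \<Rightarrow> real) \<Rightarrow> bool" where
  "smooth_fun f \<longleftrightarrow> (\<forall>x. f differentiable (at x)) \<and> continuous_on UNIV (gradient f)"

definition smooth_map :: "(real^'n \<Rightarrow> real^'m) \<Rightarrow> bool" where
  "smooth_map F \<longleftrightarrow> (\<forall>x. F differentiable (at x)) \<and> continuous_on UNIV (Jac F)"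

definition regularity_assumption ::
  "(real^'n \<Rightarrow> real) \<Rightarrow> (real^'n \<Rightarrow> ereal) \<Rightarrow> (real^'n \<Rightarrow> real^'m) \<Rightarrow> (real^'n) set \<Rightarrow>
   real \<Rightarrow> real \<Rightarrow> real \<Rightarrow> real \<Rightarrow> real \<Rightarrow> bool" where
  "regularity_assumption f g F S Mf MF Lf LF \<sigma> \<longleftrightarrow>
     0 < Mf \<and> 0 < MF \<and> 0 < Lf \<and> 0 < LF \<and> 0 < \<sigma> \<and>
     (\<forall>x\<in>S. \<forall>y\<in>S.
        norm (gradient f x) \<le> Mf \<and>
        norm (gradient f x - gradient f y) \<le> Lf * norm (x - y) \<and>
        opnorm (Jac F x) \<le> MF \<and>
        opnorm (Jac F x - Jac F y) \<le> LF * norm (x - y) \<and>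
        ereal (\<sigma> * norm (F x)) \<le> set_dist (- (transpose (Jac F x) *v F x)) (horizon_subdiff g x))"

definition first_order_optimal ::
  "(real^'n \<Rightarrow> real) \<Rightarrow> (real^'n \<Rightarrow> ereal) \<Rightarrow> (real^'n \<Rightarrow> real^'m) \<Rightarrow> real \<Rightarrow>
   real^'n \<Rightarrow> real^'m \<Rightarrow> bool" where
  "first_order_optimal f g F \<epsilon> x y \<longleftrightarrow>
     set_dist (- gradient f x - transpose (Jac F x) *v y) (limiting_subdiff g x) \<le> ereal \<epsilon> \<and>
     norm (F x) \<le> \<epsilon>"

section \<open>The algorithm\<close>

definition lin_f :: "(real^'n \<Rightarrow> real) \<Rightarrow> real^'n \<Rightarrow> real^'n \<Rightarrow> real" where
  "lin_f f x xb = f xb + inner (gradient f xb) (x - xb)"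

definition lin_F :: "(real^'n \<Rightarrow> real^'m) \<Rightarrow> real^'n \<Rightarrow> real^'n \<Rightarrow> real^'m" where
  "lin_F F x xb = F xb + Jac F xb *v (x - xb)"

definition perturbed :: "real \<Rightarrow> 'b::real_vector \<Rightarrow> 'b \<Rightarrow> 'b" where
  "perturbed \<tau> y0 y = \<tau> *\<^sub>R y0 + (1 - \<tau>) *\<^sub>R y"

(* xk is the current primal iterate and yt the perturbed multiplier. *)
definition subproblem ::
  "(real^'n \<Rightarrow> real) \<Rightarrow> (real^'n \<Rightarrow> ereal) \<Rightarrow> (real^'n \<Rightarrow> real^'m) \<Rightarrow> real \<Rightarrow> real \<Rightarrow>
   real^'n \<Rightarrow> real^'m \<Rightarrow> real^'n \<Rightarrow> ereal" where
  "subproblem f g F \<rho> \<beta> xk yt x =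
     ereal (lin_f f x xk) + g x +
     ereal (inner yt (lin_F F x xk) + \<rho> / 2 * (norm (lin_F F x xk))\<^sup>2 + \<beta> / 2 * (norm (x - xk))\<^sup>2)"

definition LIPAL ::
  "(real^'n \<Rightarrow> real) \<Rightarrow> (real^'n \<Rightarrow> ereal) \<Rightarrow> (real^'n \<Rightarrow> real^'m) \<Rightarrow> real \<Rightarrow> real \<Rightarrow> real \<Rightarrow>
   (nat \<Rightarrow> real^'n) \<Rightarrow> (nat \<Rightarrow> real^'m) \<Rightarrow> bool" where
  "LIPAL f g F \<tau> \<rho> \<beta> x y \<longleftrightarrow>
     x 0 \<in> edom g \<and>
     (\<forall>k. is_arg_min (subproblem f g F \<rho> \<beta> (x k) (perturbed \<tau> (y 0) (y k))) (\<lambda>_. True) (x (Suc k)) \<and>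
          y (Suc k) = perturbed \<tau> (y 0) (y k) + \<rho> *\<^sub>R F (x (Suc k)))"

definition dual_radius ::
  "(real^'n \<Rightarrow> real^'m) \<Rightarrow> (real^'n) set \<Rightarrow> real \<Rightarrow> real \<Rightarrow> real^'m \<Rightarrow> real" where
  "dual_radius F S \<tau> \<rho> y0 = norm y0 + \<rho> / \<tau> * (SUP x\<in>S. norm (F x))"

definition L_const ::
  "(real^'n \<Rightarrow> real^'m) \<Rightarrow> (real^'n) set \<Rightarrow> real \<Rightarrow> real \<Rightarrow> real \<Rightarrow> real \<Rightarrow> real \<Rightarrow> real^'m \<Rightarrow> real" where
  "L_const F S Lf LF MF \<tau> \<rho> y0 =
     Lf + LF * (SUP (x, y)\<in>S \<times> cball 0 (dual_radius F S \<tau> \<rho> y0). norm (perturbed \<tau> y0 y + \<rho> *\<^sub>R F x))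
     + \<rho> * MF\<^sup>2"

section \<open>The Lyapunov function\<close>

definition aug_lagrangian ::
  "(real^'n \<Rightarrow> real) \<Rightarrow> (real^'n \<Rightarrow> ereal) \<Rightarrow> (real^'n \<Rightarrow> real^'m) \<Rightarrow> real \<Rightarrow> real \<Rightarrow> real^'m \<Rightarrow>
   real^'n \<Rightarrow> real^'m \<Rightarrow> ereal" where
  "aug_lagrangian f g F \<tau> \<rho> y0 x y =
     ereal (f x) + g x + ereal (inner (perturbed \<tau> y0 y) (F x) + \<rho> / 2 * (norm (F x))\<^sup>2)"

definition lyapunov ::
  "(real^'n \<Rightarrow> real) \<Rightarrow> (real^'n \<Rightarrow> ereal) \<Rightarrow> (real^'n \<Rightarrow> real^'m) \<Rightarrow> real \<Rightarrow> real \<Rightarrow> real^'m \<Rightarrow>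
   (real^'n) \<times> (real^'m) \<times> (real^'m) \<Rightarrow> ereal" where
  "lyapunov f g F \<tau> \<rho> y0 = (\<lambda>(x, y, y').
     aug_lagrangian f g F \<tau> \<rho> y0 x y
     - ereal (\<tau> * (1 - \<tau>) / (2 * \<rho>) * (norm (y - y0))\<^sup>2)
     + ereal (2 * (1 - \<tau>)\<^sup>2 / (\<tau> * \<rho>) * (norm (y - y'))\<^sup>2))"

end

(* The values of the Lyapunov function along the iterates satisfy the two hypotheses of the standard
   Kurdyka-Lojasiewicz argument, with w k = |dx k| + (1 - tau) |dy k| measuring the k-th step.
   Sufficient decrease: comparing x (Suc k) with x k in the subproblem controls the primal part, and
   the recursion dy (Suc k) = (1 - tau) dy k + rho (F (x (k+2)) - F (x (k+1))) together with convexity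
   of the square pays for the dual part.  The summand rho MF^2 of the constant L, which the primal
   estimate does not need, makes the decrease strict even when beta attains the lower bound.
   Relative error: x (Suc k) is a global minimiser, so the optimality condition produces a Frechet
   (not just limiting) subgradient of g there; the sum rule with a smooth function is then elementary.
   Hence w is summable, and the dual recursion makes dy summable also when tau = 1.  Minimality
   against the limit point yields g (x k) --> g xs, which allows passing to the limit in the
   optimality condition; the multiplier update gives rho F xs = tau (ys - y 0). *)
theory Submission
  imports Defs
begin

section \<open>Frechet subgradients and lower semicontinuity\<close>

text \<open>The first-order error is an arbitrary positive slope \<open>e\<close>, and
  \<open>h z\<close> stands on the left, so infinite values of \<open>h w\<close> call for neither
  subtraction nor division.\<close>

definition frechet_subgradient :: "('a::real_inner \<Rightarrow> ereal) \<Rightarrow> 'a \<Rightarrow> 'a \<Rightarrow> bool" where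
  "frechet_subgradient h z v \<longleftrightarrow>
     (\<forall>e>0. \<forall>\<^sub>F w in nhds z. h z + ereal (inner v (w - z) - e * norm (w - z)) \<le> h w)"

text \<open>A point \<open>(w, a)\<close> of the epigraph has \<open>h w \<le> a\<close>, so the
  subgradient inequality bounds the numerator by \<open>e * norm (w - z)\<close>, and a component is
  no longer than the pair.\<close>

lemma frechet_subgradient_regular_normal:
  fixes h :: "'a::real_inner \<Rightarrow> ereal"
  assumes "frechet_subgradient h z v" and hz: "h z = ereal r"
  shows "(v, -1) \<in> regular_normal_cone (epi h) (z, r)"
proof -
  let ?q = "\<lambda>p. ereal (inner (v, -1) (p - (z, r)) / norm (p - (z, r)))"
  have "Limsup (at (z, r) within epi h) ?q \<le> ereal e" if "e > 0" for e
  proof (rule Limsup_bounded)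
    have ev: "\<forall>\<^sub>F w in nhds z. ereal (r + (inner v (w - z) - e * norm (w - z))) \<le> h w"
      using assms that by (auto simp: frechet_subgradient_def)
    have "filterlim fst (nhds z) (at (z, r) within epi h)"
      using tendsto_fst[OF tendsto_ident_at[of "(z, r)" "epi h"]] by simp
    from eventually_compose_filterlim[OF ev this]
    have "\<forall>\<^sub>F p in at (z, r) within epi h.
            ereal (r + (inner v (fst p - z) - e * norm (fst p - z))) \<le> h (fst p)" .
    moreover have "\<forall>\<^sub>F p in at (z, r) within epi h. p \<in> epi h"
      by (simp add: eventually_at_filter)
    moreover have "\<forall>\<^sub>F p in at (z, r) within epi h. p \<noteq> (z, r)"
      by (simp add: eventually_at_filter)
    ultimately show "\<forall>\<^sub>F p in at (z, r) within epi h. ?q p \<le> ereal e"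
    proof eventually_elim
      case (elim p)
      obtain w a where p: "p = (w, a)" by (cases p)
      have "ereal (r + (inner v (w - z) - e * norm (w - z))) \<le> ereal a"
        using order_trans[of _ "h w" "ereal a"] elim(1,2) p by (simp add: epi_def del: ereal_less_eq)
      then have "inner v (w - z) - (a - r) \<le> e * norm (w - z)"
        by simp
      also have "\<dots> \<le> e * norm (p - (z, r))"
        using norm_fst_le[of "w - z" "a - r"] that p by (simp add: mult_left_mono)
      finally show ?case
        using elim(3) p by (simp add: divide_le_eq zero_prod_def)
    qed
  qed
  then have "Limsup (at (z, r) within epi h) ?q \<le> 0"
    by (intro ereal_le_epsilon2[of _ 0]) (auto simp: ereal_le_epsilon)
  then show ?thesis
    by (simp add: regular_normal_cone_def)
qed

text \<open>Frechet subgradients give regular normals at \<open>(xs k, r k)\<close>, and it is the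
  convergence of the values \<open>r\<close> that makes these base points converge in the
  epigraph.\<close>

lemma limiting_subdiff_closed:
  assumes "\<And>k. frechet_subgradient h (xs k) (vs k)"
    and "\<And>k. h (xs k) = ereal (r k)" and "h x = ereal s"
    and "xs \<longlonglongrightarrow> x" and "vs \<longlonglongrightarrow> v" and "r \<longlonglongrightarrow> s"
  shows "v \<in> limiting_subdiff h x"
proof -
  have "(v, -1) \<in> limiting_normal_cone (epi h) (x, s)"
    unfolding limiting_normal_cone_def mem_Collect_eq
  proof (rule exI[of _ "\<lambda>k. (xs k, r k)"], rule exI[of _ "\<lambda>k. (vs k, -1)"], intro conjI allI)
    show "(xs k, r k) \<in> epi h" for k
      using assms(2) by (simp add: epi_def)
    show "(vs k, -1) \<in> regular_normal_cone (epi h) (xs k, r k)" for k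
      using assms(1,2) by (rule frechet_subgradient_regular_normal)
  qed (intro tendsto_intros assms)+
  then show ?thesis
    using assms(3) by (simp add: limiting_subdiff_def)
qed

lemma frechet_subgradient_in_limiting_subdiff:
  assumes "frechet_subgradient h z v" and "h z = ereal r"
  shows "v \<in> limiting_subdiff h z"
  using limiting_subdiff_closed[of h "\<lambda>_. z" "\<lambda>_. v" "\<lambda>_. r"] assms by simp

lemma GDERIV_eventually_norm_le:
  assumes "GDERIV q x :> D" and "e > 0"
  shows "\<forall>\<^sub>F w in nhds x. \<bar>q w - q x - inner D (w - x)\<bar> \<le> e * norm (w - x)"
  using assms unfolding gderiv_def has_derivative_at_alt eventually_nhds_metric dist_norm
  by (simp add: inner_commute)

text \<open>Fermat's rule: minimality bounds the growth of \<open>h\<close> from below by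
  \<open>q x - q w\<close>, which is \<open>inner (- D) (w - x)\<close> up to first order.\<close>

lemma frechet_subgradient_minimizer:
  fixes q :: "'a::real_inner \<Rightarrow> real"
  assumes "GDERIV q x :> D" and "\<And>z. h x + ereal (q x) \<le> h z + ereal (q z)" and "h x = ereal r"
  shows "frechet_subgradient h x (- D)"
  unfolding frechet_subgradient_def
proof (intro allI impI)
  fix e :: real assume "e > 0"
  from GDERIV_eventually_norm_le[OF assms(1) this]
  show "\<forall>\<^sub>F w in nhds x. h x + ereal (inner (- D) (w - x) - e * norm (w - x)) \<le> h w"
  proof (rule eventually_mono)
    fix w assume w: "\<bar>q w - q x - inner D (w - x)\<bar> \<le> e * norm (w - x)"
    show "h x + ereal (inner (- D) (w - x) - e * norm (w - x)) \<le> h w"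
      using assms(2)[of w] w assms(3) by (cases "h w") auto
  qed
qed

text \<open>The first-order errors of the two summands, of slope \<open>e/2\<close> each, simply
  add.\<close>

lemma frechet_subgradient_fst_plus_smooth:
  fixes Q :: "'a::real_inner \<times> 'b::real_inner \<Rightarrow> real"
  assumes "frechet_subgradient h (fst u) v" and "GDERIV Q u :> D" and "h (fst u) = ereal r"
  shows "frechet_subgradient (\<lambda>u. h (fst u) + ereal (Q u)) u ((v, 0) + D)"
  unfolding frechet_subgradient_def
proof (intro allI impI)
  fix e :: real assume e: "e > 0"
  have "\<forall>\<^sub>F z in nhds (fst u). h (fst u) + ereal (inner v (z - fst u) - e/2 * norm (z - fst u)) \<le> h z"
    using assms(1) half_gt_zero[OF e] unfolding frechet_subgradient_def by blast
  moreover have "filterlim fst (nhds (fst u)) (nhds u)"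
    by (intro tendsto_fst filterlim_ident)
  ultimately have "\<forall>\<^sub>F w in nhds u. h (fst u) +
      ereal (inner v (fst w - fst u) - e/2 * norm (fst w - fst u)) \<le> h (fst w)"
    by (rule eventually_compose_filterlim)
  moreover have "\<forall>\<^sub>F w in nhds u. \<bar>Q w - Q u - inner D (w - u)\<bar> \<le> e/2 * norm (w - u)"
    using e by (intro GDERIV_eventually_norm_le assms) auto
  ultimately show "\<forall>\<^sub>F w in nhds u. h (fst u) + ereal (Q u) +
      ereal (inner ((v, 0) + D) (w - u) - e * norm (w - u)) \<le> h (fst w) + ereal (Q w)"
  proof eventually_elim
    case (elim w)
    have "norm (fst w - fst u) \<le> norm (w - u)"
      by (metis fst_diff norm_fst_le prod.collapse)
    then have "e/2 * norm (fst w - fst u) \<le> e/2 * norm (w - u)"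
      using e by simp
    moreover have "inner ((v, 0) + D) (w - u) = inner v (fst w - fst u) + inner D (w - u)"
      by (simp add: inner_add_left inner_prod_def)
    ultimately have "inner ((v, 0) + D) (w - u) - e * norm (w - u)
        \<le> (inner v (fst w - fst u) - e/2 * norm (fst w - fst u)) + (Q w - Q u)"
      using abs_le_D2[OF elim(2)] by linarith
    then show ?case
      using elim(1) assms(3) by (cases "h (fst w)") auto
  qed
qed

lemma lsc_le_limit:
  assumes "lsc h" and X: "X \<longlonglongrightarrow> l" and "\<And>n. h (X n) \<le> ereal (a n)" and "a \<longlonglongrightarrow> b"
  shows "h l \<le> ereal b"
proof (rule ccontr)
  assume "\<not> h l \<le> ereal b"
  then obtain c where c: "ereal b < c" "c < h l"
    using dense[of "ereal b" "h l"] by (auto simp: not_le)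
  have "\<forall>\<^sub>F z in at l. c < h z"
    using assms(1) c(2) unfolding lsc_def le_Liminf_iff by blast
  \<comment> \<open>The \<open>Liminf\<close> over \<open>at l\<close> leaves out \<open>l\<close>
    itself; \<open>c < h l\<close> adds it, since \<open>X\<close> may hit its limit.\<close>
  then have "\<forall>\<^sub>F z in nhds l. c < h z"
    using c(2) by (simp add: eventually_nhds_conv_at)
  from eventually_compose_filterlim[OF this X]
  have "\<forall>\<^sub>F n in sequentially. c \<le> ereal (a n)"
    by eventually_elim (use assms(3) in \<open>auto intro: less_imp_le less_le_trans\<close>)
  moreover have "(\<lambda>n. ereal (a n)) \<longlonglongrightarrow> ereal b"
    using assms(4) by simp
  ultimately have "c \<le> ereal b"
    using tendsto_lowerbound[of "\<lambda>n. ereal (a n)" "ereal b" sequentially c] by simp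
  with c show False by simp
qed

section \<open>Smooth functions and matrices\<close>

lemma gradient_works:
  fixes f :: "real^'n \<Rightarrow> real"
  assumes "f differentiable (at x)"
  shows "GDERIV f x :> gradient f x"
proof -
  let ?f' = "frechet_derivative f (at x)"
  \<comment> \<open>Riesz representation: the derivative is a real functional, and its adjoint at 1
    is the representing vector.\<close>
  define D where "D = adjoint ?f' 1"
  have d: "(f has_derivative ?f') (at x)"
    using assms frechet_derivative_works by blast
  have "?f' = (\<lambda>h. inner h D)"
  proof
    show "?f' h = inner h D" for h
      using adjoint_works[OF has_derivative_linear[OF d], of h 1] by (simp add: D_def)
  qed
  then have "GDERIV f x :> D"
    using d by (simp add: gderiv_def)
  moreover have "D' = D" if "GDERIV f x :> D'" for D'
  proof -
    have "(\<lambda>h. inner h D') = (\<lambda>h. inner h D)"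
      using has_derivative_unique that \<open>GDERIV f x :> D\<close> unfolding gderiv_def by blast
    then have "inner (D' - D) D' = inner (D' - D) D"
      by metis
    then show ?thesis
      by (metis inner_diff_right inner_eq_zero_iff right_minus_eq)
  qed
  ultimately show ?thesis
    unfolding gradient_def by (rule theI)
qed

lemma norm_matrix_vector_le_opnorm: "norm (A *v v) \<le> opnorm A * norm v"
  unfolding opnorm_def by (rule onorm) simp

text \<open>One half of the equality of the operator norms of a matrix and its transpose: testing
  with \<open>w v* A\<close> itself leaves one factor to cancel.\<close>

lemma norm_vector_matrix_le_opnorm:
  fixes A :: "real^'n^'m"
  shows "norm (w v* A) \<le> opnorm A * norm w"
proof (cases "w v* A = 0")
  case True
  have "0 \<le> opnorm A"
    unfolding opnorm_def by (rule onorm_pos_le) simp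
  with True show ?thesis by simp
next
  case False
  let ?t = "w v* A"
  have "norm ?t * norm ?t = inner w (A *v ?t)"
    using dot_lmul_matrix[of w A ?t] by (simp add: dot_square_norm power2_eq_square)
  also have "\<dots> \<le> norm w * (opnorm A * norm ?t)"
    using norm_cauchy_schwarz norm_matrix_vector_le_opnorm[of A ?t]
    by (meson mult_left_mono norm_ge_zero order_trans)
  finally show ?thesis
    using False by (simp add: mult.commute mult.left_commute mult_le_cancel_left_pos)
qed

text \<open>The deviation of the derivative from its value at \<open>a\<close> is integrated along
  the segment; the comparison function \<open>?\<psi>\<close> has derivative
  \<open>L * t * (norm ?v)\<^sup>2\<close>, which supplies the factor 1/2.\<close>

lemma quadratic_upper_bound:
  fixes h :: "'a::real_normed_vector \<Rightarrow> 'b::real_normed_vector"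
  assumes der: "\<And>z. (h has_derivative h' z) (at z)"
    and lip: "\<And>z v. z \<in> closed_segment a b \<Longrightarrow> norm (h' z v - h' a v) \<le> L * norm (z - a) * norm v"
  shows "norm (h b - h a - h' a (b - a)) \<le> L / 2 * (norm (b - a))\<^sup>2"
proof -
  let ?v = "b - a"
  let ?p = "\<lambda>t. a + t *\<^sub>R ?v"
  let ?\<phi> = "\<lambda>t. h (?p t) - t *\<^sub>R h' a ?v"
  let ?\<psi> = "\<lambda>t. L / 2 * t\<^sup>2 * (norm ?v)\<^sup>2"
  have d: "(?\<phi> has_vector_derivative (h' (?p t) ?v - h' a ?v)) (at t)" for t
  proof -
    have "((\<lambda>t. ?p t) has_derivative (\<lambda>s. s *\<^sub>R ?v)) (at t)"
      by (auto intro!: derivative_eq_intros)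
    from has_derivative_compose[OF this der]
    have "((\<lambda>t. h (?p t)) has_derivative (\<lambda>s. h' (?p t) (s *\<^sub>R ?v))) (at t)" .
    then have "((\<lambda>t. h (?p t)) has_vector_derivative h' (?p t) ?v) (at t)"
      unfolding has_vector_derivative_def
      using linear_scale[OF has_derivative_linear[OF der]] by simp
    then show ?thesis
      by (auto intro!: derivative_eq_intros)
  qed
  have "norm (?\<phi> 1 - ?\<phi> 0) \<le> ?\<psi> 1 - ?\<psi> 0"
  proof (rule differentiable_bound_general[where \<phi>' = "\<lambda>t. L * t * (norm ?v)\<^sup>2"])
    show "continuous_on {0..1} ?\<phi>"
      using d has_vector_derivative_continuous continuous_at_imp_continuous_on by blast
    show "continuous_on {0..1} ?\<psi>"
      by (intro continuous_intros)
    show "(?\<phi> has_vector_derivative (h' (?p t) ?v - h' a ?v)) (at t)" for t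
      by (rule d)
    show "(?\<psi> has_vector_derivative L * t * (norm ?v)\<^sup>2) (at t)" for t
      unfolding has_real_derivative_iff_has_vector_derivative[symmetric]
      by (auto intro!: derivative_eq_intros)
    fix t :: real assume t: "0 < t" "t < 1"
    have "?p t \<in> closed_segment a b"
      using t by (auto simp: in_segment algebra_simps intro!: exI[of _ t])
    from lip[OF this, of ?v] show "norm (h' (?p t) ?v - h' a ?v) \<le> L * t * (norm ?v)\<^sup>2"
      using t by (simp add: power2_eq_square mult.assoc)
  qed simp
  then show ?thesis
    by (simp add: algebra_simps)
qed

lemma inner_vector_matrix: "inner h (w v* A) = inner w (A *v h)" for w :: "real^'k" and A :: "real^'l^'k"
  by (simp add: dot_lmul_matrix[symmetric] inner_commute)

lemma tendsto_matrix_vector_mult: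
  fixes A :: "'a \<Rightarrow> real^'n^'m"
  assumes "(A \<longlongrightarrow> A0) net" "(v \<longlongrightarrow> v0) net"
  shows "((\<lambda>k. A k *v v k) \<longlongrightarrow> A0 *v v0) net"
  unfolding matrix_vector_mult_def by (intro tendsto_intros assms)

lemma tendsto_vector_matrix_mult:
  fixes A :: "'a \<Rightarrow> real^'n^'m"
  assumes "(v \<longlongrightarrow> v0) net" "(A \<longlongrightarrow> A0) net"
  shows "((\<lambda>k. v k v* A k) \<longlongrightarrow> v0 v* A0) net"
  unfolding vector_matrix_mult_def by (intro tendsto_intros assms)

section \<open>Algebra of the perturbed multiplier\<close>

lemma perturbed_diff: "perturbed \<tau> z a - perturbed \<tau> z b = (1 - \<tau>) *\<^sub>R (a - b)"
  by (simp add: perturbed_def algebra_simps)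

text \<open>With \<open>e\<close> the old offset from \<open>y 0\<close>, \<open>d\<close> the
  multiplier step and \<open>(1 / \<rho>) *\<^sub>R (d + \<tau> *\<^sub>R e)\<close> the constraint
  value, this is the effect of a multiplier update on the bilinear and concave terms of the Lyapunov
  function. The products \<open>inner d e\<close> cancel, which explains the coefficient
  \<open>\<tau> * (1 - \<tau>) / (2 * \<rho>)\<close>.\<close>

lemma dual_step_identity:
  fixes d e :: "'a::real_inner"
  assumes "0 < \<rho>"
  shows "(1 - \<tau>) * inner d ((1 / \<rho>) *\<^sub>R (d + \<tau> *\<^sub>R e))
    - \<tau> * (1 - \<tau>) / (2 * \<rho>) * ((norm (e + d))\<^sup>2 - (norm e)\<^sup>2)
    = (1 - \<tau>) * (2 - \<tau>) / (2 * \<rho>) * (norm d)\<^sup>2"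
  using assms by (simp add: power2_norm_eq_inner inner_add_left inner_add_right inner_commute field_simps)

text \<open>Convexity of the square at the points \<open>a\<close> and \<open>t / \<tau>\<close>
  with weights \<open>1 - \<tau>\<close> and \<open>\<tau>\<close>.\<close>

lemma square_convex_combination_le:
  fixes a t \<tau> :: real
  assumes "0 < \<tau>" "\<tau> \<le> 1"
  shows "((1 - \<tau>) * a + t)\<^sup>2 \<le> (1 - \<tau>) * a\<^sup>2 + t\<^sup>2 / \<tau>"
proof -
  have "(1 - \<tau>) * a\<^sup>2 + t\<^sup>2 / \<tau> - ((1 - \<tau>) * a + t)\<^sup>2 = (1 - \<tau>) / \<tau> * (\<tau> * a - t)\<^sup>2"
    using assms by (simp add: power2_eq_square field_simps)
  also have "0 \<le> \<dots>"
    using assms by simp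
  finally show ?thesis by simp
qed

section \<open>Summability under the Kurdyka-Lojasiewicz property\<close>

text \<open>Summing the recursion bounds each partial sum by \<open>q\<close> times the preceding
  one plus a constant; the preceding one is no larger, so for \<open>q < 1\<close> it can be
  absorbed.\<close>

lemma summable_nonneg_contraction:
  fixes d e :: "nat \<Rightarrow> real"
  assumes "\<And>k. 0 \<le> d k" and e: "\<And>k. 0 \<le> e k" "summable e" and "0 \<le> q" "q < 1"
    and rec: "\<And>k. d (Suc k) \<le> q * d k + e k"
  shows "summable d"
proof (rule summableI_nonneg_bounded)
  fix n
  have *: "sum d {..<Suc n} \<le> d 0 + q * sum d {..<n} + sum e {..<n}" for n
  proof (induction n)
    case (Suc n)
    with rec[of n] show ?case by (simp add: distrib_left)
  qed simp
  have "sum d {..<n} \<le> sum d {..<Suc n}" using assms(1) by simp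
  also note *[of n]
  finally have "(1 - q) * sum d {..<n} \<le> d 0 + sum e {..<n}"
    by (simp add: algebra_simps)
  also have "\<dots> \<le> d 0 + suminf e"
    using sum_le_suminf[OF e(2)] e(1) by simp
  finally show "sum d {..<n} \<le> (d 0 + suminf e) / (1 - q)"
    using \<open>q < 1\<close> by (simp add: field_simps)
qed (rule assms(1))

lemma summable_of_square_le_mult_diff:
  fixes w p :: "nat \<Rightarrow> real"
  assumes w: "\<And>k. 0 \<le> w k" and p: "\<And>k. 0 \<le> p k" "\<And>k. p (Suc k) \<le> p k" and "0 \<le> K"
    and rec: "\<And>k. (w (Suc k))\<^sup>2 \<le> w k * (K * (p k - p (Suc k)))"
  shows "summable w"
proof (rule summable_nonneg_contraction[OF w])
  let ?e = "\<lambda>k. K / 2 * (p k - p (Suc k))"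
  show "0 \<le> ?e k" for k
    using p(2) \<open>0 \<le> K\<close> by simp
  obtain L where "p \<longlonglongrightarrow> L"
    using decseq_convergent[of p 0] decseq_SucI[of p] p by blast
  then have "summable (\<lambda>k. p k - p (Suc k))"
    by (rule telescope_summable')
  then show "summable ?e"
    by (rule summable_mult)
  fix k
  \<comment> \<open>The arithmetic-geometric mean inequality turns the recursion into a contraction
    of factor 1/2 plus a telescoping term.\<close>
  have "w k * (K * (p k - p (Suc k))) \<le> ((w k + K * (p k - p (Suc k))) / 2)\<^sup>2"
    using zero_le_power2[of "w k - K * (p k - p (Suc k))"]
    by (simp add: power2_eq_square field_simps)
  with rec[of k] have "(w (Suc k))\<^sup>2 \<le> ((w k + K * (p k - p (Suc k))) / 2)\<^sup>2"
    by linarith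
  then have "w (Suc k) \<le> (w k + K * (p k - p (Suc k))) / 2"
    by (rule power2_le_imp_le) (simp add: w p(2) \<open>0 \<le> K\<close>)
  then show "w (Suc k) \<le> 1 / 2 * w k + ?e k"
    by (simp add: field_simps)
qed auto

lemma concave_on_tangent_le:
  assumes "concave_on A \<phi>" "connected A" "c \<in> interior A" "x \<in> A" "\<phi> differentiable (at c)"
  shows "deriv \<phi> c * (c - x) \<le> \<phi> c - \<phi> (x::real)"
proof -
  have "(\<phi> has_field_derivative deriv \<phi> c) (at c)"
    using assms(5) DERIV_deriv_iff_real_differentiable by blast
  then have "((\<lambda>t. - \<phi> t) has_field_derivative - deriv \<phi> c) (at c within A)"
    by (intro DERIV_minus) (rule has_field_derivative_at_within)
  from convex_on_imp_above_tangent[OF _ assms(2-4) this] show ?thesis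
    using assms(1) by (simp add: concave_on_def right_diff_distrib)
qed

text \<open>A subsequence staying away from the limit points would, by boundedness, have a
  convergent subsequence, whose limit is itself a limit point.\<close>

lemma eventually_set_dist_limit_points:
  fixes u :: "nat \<Rightarrow> 'a::heine_borel"
  assumes "bounded (range u)" and "0 < \<epsilon>"
  shows "\<forall>\<^sub>F k in sequentially. set_dist (u k) (limit_points u) < ereal \<epsilon>"
proof (rule ccontr)
  assume "\<not> ?thesis"
  then obtain r :: "nat \<Rightarrow> nat" where r: "strict_mono r" "\<And>k. \<not> set_dist (u (r k)) (limit_points u) < ereal \<epsilon>"
    using not_eventually_sequentiallyD[of "\<lambda>k. set_dist (u k) (limit_points u) < ereal \<epsilon>"] by auto
  have "bounded (range (u \<circ> r))"
    using assms(1) by (rule bounded_subset) auto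
  then obtain l r' where r': "strict_mono r'" "((u \<circ> r) \<circ> r') \<longlonglongrightarrow> l"
    using bounded_imp_convergent_subsequence by blast
  then have l: "l \<in> limit_points u"
    unfolding limit_points_def using strict_mono_o[OF r(1) r'(1)]
    by (auto intro!: exI[of _ "r \<circ> r'"] simp: o_assoc)
  obtain k where "dist (u (r (r' k))) l < \<epsilon>"
    using tendstoD[OF r'(2) \<open>0 < \<epsilon>\<close>] by (auto simp: eventually_sequentially)
  then have "set_dist (u (r (r' k))) (limit_points u) < ereal \<epsilon>"
    unfolding set_dist_def using l by (intro INF_lower2[THEN le_less_trans]) auto
  with r(2) show False by blast
qed

lemma set_dist_le: "a \<in> A \<Longrightarrow> set_dist z A \<le> ereal (dist z a)"
  unfolding set_dist_def by (rule INF_lower)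

text \<open>KL and the error bound at \<open>u k\<close> give
  \<open>1 \<le> deriv \<phi> (p k - q) * (C * w k)\<close>. Concavity of \<open>\<phi>\<close> then
  converts the decrease into \<open>c * (w (Suc k))\<^sup>2 \<le> C * w k * (\<phi> (p k - q) -
  \<phi> (p (Suc k) - q))\<close>, the shape required by
  \<open>summable_of_square_le_mult_diff\<close>.\<close>

lemma KL_on_summable:
  fixes \<Phi> :: "'a::euclidean_space \<Rightarrow> ereal"
  assumes KL: "KL_on \<Phi> (limit_points u)" and bdd: "bounded (range u)"
    and \<Phi>u: "\<And>k. \<Phi> (u k) = ereal (p k)" and \<Phi>l: "\<And>l. l \<in> limit_points u \<Longrightarrow> \<Phi> l = ereal q"
    and lim: "p \<longlonglongrightarrow> q" and w: "\<And>k. 0 \<le> w k"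
    and "0 < c" and decr: "\<And>k. p (Suc k) \<le> p k - c * (w (Suc k))\<^sup>2"
    and s: "\<And>k. s k \<in> limiting_subdiff \<Phi> (u k)" "\<And>k. norm (s k) \<le> C * w k"
  shows "summable w"
proof -
  have p_Suc: "p (Suc k) \<le> p k" for k
  proof -
    have "0 \<le> c * (w (Suc k))\<^sup>2" using \<open>0 < c\<close> by simp
    with decr[of k] show ?thesis by linarith
  qed
  then have p_anti: "p m \<le> p n" if "n \<le> m" for m n
    using that by (rule lift_Suc_antimono_le[of p])
  have q_le: "q \<le> p k" for k
    using p_Suc lim by (intro decseq_ge) (auto intro: decseq_SucI)
  show ?thesis
  proof (cases "\<exists>N. p N = q")
    \<comment> \<open>KL says nothing where the limiting value is attained, but then
      \<open>p\<close> stays at \<open>q\<close> and the decrease forces \<open>w\<close> to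
      vanish.\<close>
    case True
    then obtain N where N: "p N = q" by blast
    have "w k = 0" if "k > N" for k
    proof -
      obtain j where j: "k = Suc j" "j \<ge> N"
        using \<open>k > N\<close> by (cases k) auto
      have "p j = q" using p_anti[OF j(2)] q_le[of j] N by simp
      with decr[of j] q_le[of k] j have "c * (w k)\<^sup>2 \<le> 0" by simp
      with \<open>0 < c\<close> show ?thesis by (simp add: mult_le_0_iff)
    qed
    then show ?thesis
      by (intro summable_finite[of "{..N}"]) auto
  next
    case False
    then have q_less: "q < p k" for k
      using q_le[of k] by (metis order_le_less)
    from KL obtain \<epsilon> \<eta> \<phi> where "0 < \<epsilon>" "0 < \<eta>" and \<phi>: "desingularizing \<eta> \<phi>"
      and KL': "\<And>v u'. v \<in> limit_points u \<Longrightarrow> set_dist u' (limit_points u) < ereal \<epsilon> \<Longrightarrow> \<Phi> v < \<Phi> u' \<Longrightarrow>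
        \<Phi> u' < \<Phi> v + \<eta> \<Longrightarrow>
        1 \<le> ereal (deriv \<phi> (real_of_ereal (\<Phi> u' - \<Phi> v))) * set_dist 0 (limiting_subdiff \<Phi> u')"
      unfolding KL_on_def by blast
    define D where "D = {t. 0 \<le> t \<and> ereal t \<le> \<eta>}"
    define I where "I = {t. 0 < t \<and> ereal t < \<eta>}"
    have \<phi>D: "concave_on D \<phi>" "\<And>t. t \<in> D \<Longrightarrow> 0 \<le> \<phi> t"
      and \<phi>I: "\<And>t. t \<in> I \<Longrightarrow> \<phi> differentiable (at t)" "\<And>t. t \<in> I \<Longrightarrow> 0 < deriv \<phi> t"
      using \<phi> unfolding desingularizing_def Let_def D_def I_def by auto
    have I_int: "I \<subseteq> interior D"
      unfolding I_def D_def
      by (intro interior_maximal open_Collect_conj open_Collect_less continuous_intros) auto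
    have "connected D"
      using \<phi>D(1) concave_on_imp_convex convex_connected by blast
    obtain l where l: "l \<in> limit_points u"
      using bounded_imp_convergent_subsequence[OF bdd] unfolding limit_points_def by blast
    have "\<forall>\<^sub>F k in sequentially. ereal (p k - q) < \<eta>"
    proof -
      have "(\<lambda>k. ereal (p k - q)) \<longlonglongrightarrow> ereal (q - q)"
        using lim by (intro tendsto_intros)
      then show ?thesis
        using \<open>0 < \<eta>\<close> by (intro order_tendstoD(2)) (auto simp: zero_ereal_def)
    qed
    with eventually_set_dist_limit_points[OF bdd \<open>0 < \<epsilon>\<close>]
    have "\<forall>\<^sub>F k in sequentially. set_dist (u k) (limit_points u) < ereal \<epsilon> \<and> ereal (p k - q) < \<eta>"
      by (rule eventually_conj)
    then obtain N where N: "\<And>k. k \<ge> N \<Longrightarrow> set_dist (u k) (limit_points u) < ereal \<epsilon>"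
        "\<And>k. k \<ge> N \<Longrightarrow> ereal (p k - q) < \<eta>"
      unfolding eventually_sequentially by blast
    have I: "p k - q \<in> I" if "k \<ge> N" for k
      using q_less[of k] N(2)[OF that] by (simp add: I_def)
    have D: "p k - q \<in> D" if "k \<ge> N" for k
      using I[OF that] by (auto simp: I_def D_def)
    have KL_ineq: "1 \<le> deriv \<phi> (p k - q) * (C * w k)" if k: "k \<ge> N" for k
    proof -
      have "\<Phi> (u k) < \<Phi> l + \<eta>"
        using N(2)[OF k] \<Phi>l[OF l] \<Phi>u by (cases \<eta>) auto
      then have "1 \<le> ereal (deriv \<phi> (p k - q)) * set_dist 0 (limiting_subdiff \<Phi> (u k))"
        using KL'[OF l N(1)[OF k]] \<Phi>l[OF l] \<Phi>u q_less[of k] by simp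
      also have "set_dist 0 (limiting_subdiff \<Phi> (u k)) \<le> ereal (C * w k)"
        using set_dist_le[OF s(1)[of k], of 0] s(2)[of k] by (auto intro: order_trans)
      finally show ?thesis
        using \<phi>I(2)[OF I[OF k]] by (simp add: ereal_mult_left_mono one_ereal_def)
    qed
    \<comment> \<open>A negative \<open>C\<close> would make the right side of the KL inequality at
      \<open>N\<close> nonpositive.\<close>
    have "0 \<le> C"
    proof (rule ccontr)
      assume "\<not> 0 \<le> C"
      then have "deriv \<phi> (p N - q) * (C * w N) \<le> 0"
        using \<phi>I(2)[OF I[of N]] w[of N] by (simp add: mult_le_0_iff)
      with KL_ineq[of N] show False by simp
    qed
    have rec: "(w (Suc k))\<^sup>2 \<le> w k * (C / c * (\<phi> (p k - q) - \<phi> (p (Suc k) - q)))" if k: "k \<ge> N" for k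
    proof -
      let ?d = "deriv \<phi> (p k - q)"
      have "?d * (p k - p (Suc k)) \<le> \<phi> (p k - q) - \<phi> (p (Suc k) - q)"
        using concave_on_tangent_le[OF \<phi>D(1) \<open>connected D\<close>, of "p k - q" "p (Suc k) - q"]
          I[OF k] I_int D[of "Suc k"] \<phi>I(1)[OF I[OF k]] k by auto
      moreover have "?d * (c * (w (Suc k))\<^sup>2) \<le> ?d * (p k - p (Suc k))"
        using decr[of k] \<phi>I(2)[OF I[OF k]] by (intro mult_left_mono) auto
      ultimately have "?d * (c * (w (Suc k))\<^sup>2) \<le> \<phi> (p k - q) - \<phi> (p (Suc k) - q)"
        by linarith
      \<comment> \<open>The factor \<open>C * w k\<close> completes the product that
        \<open>KL_ineq\<close> bounds below by 1, which eliminates the unknown slope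
        \<open>?d\<close>.\<close>
      then have "(C * w k) * (?d * (c * (w (Suc k))\<^sup>2)) \<le> (C * w k) * (\<phi> (p k - q) - \<phi> (p (Suc k) - q))"
        using \<open>0 \<le> C\<close> w by (intro mult_left_mono) auto
      moreover have "1 * (c * (w (Suc k))\<^sup>2) \<le> (?d * (C * w k)) * (c * (w (Suc k))\<^sup>2)"
        using KL_ineq[OF k] \<open>0 < c\<close> by (intro mult_right_mono) auto
      ultimately have "c * (w (Suc k))\<^sup>2 \<le> (C * w k) * (\<phi> (p k - q) - \<phi> (p (Suc k) - q))"
        by (simp add: mult_ac)
      then show ?thesis
        using \<open>0 < c\<close> by (simp add: field_simps)
    qed
    have \<phi>_mono: "\<phi> (p (Suc k) - q) \<le> \<phi> (p k - q)" if k: "k \<ge> N" for k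
    proof -
      have "0 \<le> deriv \<phi> (p k - q) * (p k - p (Suc k))"
        using \<phi>I(2)[OF I[OF k]] p_Suc[of k] by simp
      then show ?thesis
        using concave_on_tangent_le[OF \<phi>D(1) \<open>connected D\<close>, of "p k - q" "p (Suc k) - q"]
          I[OF k] I_int D[of "Suc k"] \<phi>I(1)[OF I[OF k]] k by auto
    qed
    have "summable (\<lambda>k. w (k + N))"
    proof (rule summable_of_square_le_mult_diff)
      show "0 \<le> \<phi> (p (k + N) - q)" for k
        by (intro \<phi>D(2) D) simp
      show "\<phi> (p (Suc k + N) - q) \<le> \<phi> (p (k + N) - q)" for k
        using \<phi>_mono[of "k + N"] by simp
      show "(w (Suc k + N))\<^sup>2 \<le> w (k + N) * (C / c * (\<phi> (p (k + N) - q) - \<phi> (p (Suc k + N) - q)))" for k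
        using rec[of "k + N"] by simp
      show "0 \<le> C / c"
        using \<open>0 \<le> C\<close> \<open>0 < c\<close> by simp
    qed (rule w)
    then show ?thesis
      by (simp add: summable_iff_shift)
  qed
qed

lemma summable_increments_imp_convergent:
  fixes x :: "nat \<Rightarrow> 'a::banach"
  assumes "summable (\<lambda>k. norm (x (Suc k) - x k))"
  obtains l where "x \<longlonglongrightarrow> l"
proof -
  have "(\<lambda>n. \<Sum>k<n. x (Suc k) - x k) \<longlonglongrightarrow> (\<Sum>k. x (Suc k) - x k)"
    by (intro summable_LIMSEQ summable_norm_cancel[OF assms])
  then have "(\<lambda>n. x n - x 0 + x 0) \<longlonglongrightarrow> (\<Sum>k. x (Suc k) - x k) + x 0"
    by (intro tendsto_add tendsto_const) (simp add: sum_lessThan_telescope)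
  with that show thesis by simp
qed

section \<open>The iterates of LIPAL\<close>

text \<open>The Taylor estimates run along the segments between consecutive iterates;
  \<open>segment_in\<close> makes the Lipschitz bounds on the possibly nonconvex \<open>S\<close>
  available there.\<close>

locale lipal_run =
  fixes f :: "real^'n \<Rightarrow> real" and g :: "real^'n \<Rightarrow> ereal" and F :: "real^'n \<Rightarrow> real^'m"
    and S :: "(real^'n) set"
    and \<tau> \<rho> \<beta> Mf MF Lf LF \<sigma> :: real
    and x :: "nat \<Rightarrow> real^'n" and y :: "nat \<Rightarrow> real^'m"
  assumes smooth_f: "smooth_fun f" and smooth_F: "smooth_map F" and proper_g: "proper_fun g"
    and \<tau>: "0 < \<tau>" "\<tau> \<le> 1" and \<rho>: "0 < \<rho>" and \<beta>: "0 < \<beta>"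
    and LIPAL: "LIPAL f g F \<tau> \<rho> \<beta> x y"
    and compact_S: "compact S" and x_in: "\<And>k. x k \<in> S"
    and segment_in: "\<And>k. closed_segment (x k) (x (Suc k)) \<subseteq> S"
    and regularity: "regularity_assumption f g F S Mf MF Lf LF \<sigma>"
    and \<beta>_ge: "\<beta> \<ge> max (2 * L_const F S Lf LF MF \<tau> \<rho> (y 0)) (8 * (1 - \<tau>) * \<rho> * MF\<^sup>2 / \<tau>\<^sup>2)"
begin

abbreviation "yt k \<equiv> perturbed \<tau> (y 0) (y k)"
abbreviation "dx k \<equiv> norm (x (Suc k) - x k)"
abbreviation "dy k \<equiv> norm (y (Suc k) - y k)"

text \<open>The real-valued summands of the subproblem, separated so that \<open>g\<close> is the
  only extended-real term.\<close>

definition model :: "real^'n \<Rightarrow> real^'m \<Rightarrow> real^'n \<Rightarrow> real" where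
  "model a w z = lin_f f z a + inner w (lin_F F z a) + \<rho> / 2 * (norm (lin_F F z a))\<^sup>2
     + \<beta> / 2 * (norm (z - a))\<^sup>2"

definition gx :: "nat \<Rightarrow> real" where
  "gx k = real_of_ereal (g (x k))"

text \<open>The Lyapunov function without \<open>g\<close>: real-valued and differentiable.\<close>

definition smooth_part :: "(real^'n) \<times> (real^'m) \<times> (real^'m) \<Rightarrow> real" where
  "smooth_part = (\<lambda>(z, w, w'). f z + inner (perturbed \<tau> (y 0) w) (F z) + \<rho> / 2 * (norm (F z))\<^sup>2
     - \<tau> * (1 - \<tau>) / (2 * \<rho>) * (norm (w - y 0))\<^sup>2
     + 2 * (1 - \<tau>)\<^sup>2 / (\<tau> * \<rho>) * (norm (w - w'))\<^sup>2)"

text \<open>Shifted by one: the triple contains a previous multiplier, so \<open>u 0\<close> is the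
  state after the first iteration, and \<open>lyap k\<close> is the Lyapunov value of index k +
  1.\<close>

definition u :: "nat \<Rightarrow> (real^'n) \<times> (real^'m) \<times> (real^'m)" where
  "u k = (x (Suc k), y (Suc k), y k)"

definition lyap :: "nat \<Rightarrow> real" where
  "lyap k = gx (Suc k) + smooth_part (u k)"

definition dual_bound :: real where
  "dual_bound = (SUP (z, w)\<in>S \<times> cball 0 (dual_radius F S \<tau> \<rho> (y 0)). norm (perturbed \<tau> (y 0) w + \<rho> *\<^sub>R F z))"

section \<open>Smoothness, Lipschitz bounds and finiteness of \<open>g\<close> along the run\<close>

lemma GDERIV_f: "GDERIV f z :> gradient f z"
  using smooth_f by (intro gradient_works) (simp add: smooth_fun_def)

lemma has_derivative_f: "(f has_derivative (\<lambda>h. inner h (gradient f z))) (at z)"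
  using GDERIV_f by (simp add: gderiv_def)

lemma has_derivative_F: "(F has_derivative (\<lambda>h. Jac F z *v h)) (at z)"
  using smooth_F jacobian_works by (auto simp: smooth_map_def)

lemma shows isCont_f: "isCont f z" and isCont_F: "isCont F z"
  using has_derivative_f has_derivative_F has_derivative_continuous by blast+

lemma shows isCont_gradient: "isCont (gradient f) z" and isCont_Jac: "isCont (\<lambda>z. Jac F z) z"
  using smooth_f smooth_F by (auto simp: smooth_fun_def smooth_map_def continuous_on_eq_continuous_at)

lemma pos_consts: "0 < Mf" "0 < MF" "0 < Lf" "0 < LF" "0 < \<sigma>"
  using regularity by (auto simp: regularity_assumption_def)

lemma lipschitz:
  assumes "z \<in> S" "z' \<in> S"
  shows "norm (gradient f z - gradient f z') \<le> Lf * norm (z - z')"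
    and "opnorm (Jac F z) \<le> MF"
    and "opnorm (Jac F z - Jac F z') \<le> LF * norm (z - z')"
  using regularity assms by (auto simp: regularity_assumption_def)

lemma y_Suc: "y (Suc k) = yt k + \<rho> *\<^sub>R F (x (Suc k))"
  using LIPAL by (simp add: LIPAL_def)

lemma g_not_minf: "g z \<noteq> - \<infinity>"
  using proper_g by (simp add: proper_fun_def)

lemma subproblem_eq: "subproblem f g F \<rho> \<beta> a w z = g z + ereal (model a w z)"
  by (cases "g z") (simp_all add: subproblem_def model_def)

lemma model_minimal:
  "g (x (Suc k)) + ereal (model (x k) (yt k) (x (Suc k))) \<le> g z + ereal (model (x k) (yt k) z)"
  using LIPAL by (auto simp: LIPAL_def is_arg_min_linorder subproblem_eq)

lemma g_x: "g (x k) = ereal (gx k)"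
proof -
  have "g (x k) < \<infinity>"
  proof (induction k)
    case 0
    then show ?case using LIPAL by (simp add: LIPAL_def edom_def)
  next
    case (Suc k)
    then show ?case using model_minimal[of k "x k"]
      by (cases "g (x k)"; cases "g (x (Suc k))") auto
  qed
  then show ?thesis
    using g_not_minf[of "x k"] by (cases "g (x k)") (auto simp: gx_def)
qed

lemma lyapunov_eq: "lyapunov f g F \<tau> \<rho> (y 0) v = g (fst v) + ereal (smooth_part v)"
  by (cases v; cases "g (fst v)") (auto simp: lyapunov_def aug_lagrangian_def smooth_part_def)

lemma lyapunov_u: "lyapunov f g F \<tau> \<rho> (y 0) (u k) = ereal (lyap k)"
  by (simp add: lyapunov_eq lyap_def u_def g_x)

section \<open>Uniform bounds on constraint values and multipliers\<close>

lemma norm_F_le: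
  assumes "z \<in> S"
  shows "norm (F z) \<le> (SUP z\<in>S. norm (F z))"
proof (rule cSUP_upper[OF assms])
  have "compact ((\<lambda>z. norm (F z)) ` S)"
    using compact_S isCont_F
    by (intro compact_continuous_image) (auto intro!: continuous_at_imp_continuous_on continuous_intros)
  then show "bdd_above ((\<lambda>z. norm (F z)) ` S)"
    by (intro bounded_imp_bdd_above compact_imp_bounded)
qed

text \<open>With \<open>?\<Delta>\<close> the supremum of \<open>norm (F z)\<close> on
  \<open>S\<close>, the radius is the fixed point of \<open>r \<mapsto> \<tau> * norm (y 0) + (1 -
  \<tau>) * r + \<rho> * ?\<Delta>\<close>, the bound that one multiplier update yields.\<close>

lemma norm_y_le: "norm (y k) \<le> dual_radius F S \<tau> \<rho> (y 0)"
proof (induction k)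
  let ?\<Delta> = "SUP z\<in>S. norm (F z)"
  have \<Delta>: "0 \<le> ?\<Delta>"
    using norm_F_le[OF x_in[of 0]] norm_ge_zero order_trans by blast
  {
    case 0
    show ?case using \<tau> \<rho> \<Delta> by (simp add: dual_radius_def)
  next
    case (Suc k)
    have "norm (y (Suc k)) \<le> norm (\<tau> *\<^sub>R y 0) + norm ((1 - \<tau>) *\<^sub>R y k) + norm (\<rho> *\<^sub>R F (x (Suc k)))"
      unfolding y_Suc perturbed_def
      by (rule order_trans[OF norm_triangle_ineq]) (simp add: norm_triangle_ineq del: norm_scaleR)
    also have "\<dots> = \<tau> * norm (y 0) + (1 - \<tau>) * norm (y k) + \<rho> * norm (F (x (Suc k)))"
      using \<tau> \<rho> by simp
    also have "\<dots> \<le> \<tau> * norm (y 0) + (1 - \<tau>) * dual_radius F S \<tau> \<rho> (y 0) + \<rho> * ?\<Delta>"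
      using Suc norm_F_le[OF x_in] \<tau> \<rho> by (intro add_mono mult_left_mono) auto
    also have "\<dots> = dual_radius F S \<tau> \<rho> (y 0)"
      using \<tau> by (simp add: dual_radius_def field_simps)
    finally show ?case .
  }
qed

text \<open>A real supremum is an upper bound only for sets bounded above; compactness of the
  product and continuity ensure this.\<close>

lemma norm_multiplier_le:
  assumes "z \<in> S"
  shows "norm (yt k + \<rho> *\<^sub>R F z) \<le> dual_bound"
proof -
  let ?h = "\<lambda>p. norm (perturbed \<tau> (y 0) (snd p) + \<rho> *\<^sub>R F (fst p))"
  let ?A = "S \<times> cball 0 (dual_radius F S \<tau> \<rho> (y 0))"
  have "continuous_on ?A ?h"
    unfolding perturbed_def
    by (intro continuous_at_imp_continuous_on ballI continuous_intros isCont_o2[OF _ isCont_F])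
  then have "compact (?h ` ?A)"
    by (intro compact_continuous_image compact_Times compact_S compact_cball)
  then have "bdd_above (?h ` ?A)"
    by (intro bounded_imp_bdd_above compact_imp_bounded)
  moreover have "(z, y k) \<in> ?A"
    using assms norm_y_le by simp
  ultimately have "?h (z, y k) \<le> (SUP p\<in>?A. ?h p)"
    by (intro cSUP_upper)
  then show ?thesis
    by (simp add: dual_bound_def case_prod_unfold)
qed

lemma dual_bound_nonneg: "0 \<le> dual_bound"
  using norm_multiplier_le[OF x_in[of 0], of 0] norm_ge_zero order_trans by blast

section \<open>Taylor errors and descent of the primal step\<close>

lemma lin_f_error: "f (x (Suc k)) - lin_f f (x (Suc k)) (x k) \<le> Lf / 2 * (dx k)\<^sup>2"
proof -
  have "norm (f (x (Suc k)) - f (x k) - inner (x (Suc k) - x k) (gradient f (x k))) \<le> Lf / 2 * (dx k)\<^sup>2"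
  proof (rule quadratic_upper_bound[OF has_derivative_f])
    fix z v assume "z \<in> closed_segment (x k) (x (Suc k))"
    then have "z \<in> S" using segment_in by blast
    have "norm (inner v (gradient f z) - inner v (gradient f (x k)))
        \<le> norm v * norm (gradient f z - gradient f (x k))"
      using Cauchy_Schwarz_ineq2[of v "gradient f z - gradient f (x k)"] by (simp add: inner_diff_right)
    also have "\<dots> \<le> norm v * (Lf * norm (z - x k))"
      by (intro mult_left_mono lipschitz(1) \<open>z \<in> S\<close> x_in) simp
    finally show "norm (inner v (gradient f z) - inner v (gradient f (x k))) \<le> Lf * norm (z - x k) * norm v"
      by (simp add: mult_ac)
  qed
  then show ?thesis
    unfolding lin_f_def real_norm_def inner_commute[of "gradient f (x k)"] by linarith
qed

lemma lin_F_error: "norm (F (x (Suc k)) - lin_F F (x (Suc k)) (x k)) \<le> LF / 2 * (dx k)\<^sup>2"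
proof -
  have "norm (F (x (Suc k)) - F (x k) - Jac F (x k) *v (x (Suc k) - x k)) \<le> LF / 2 * (dx k)\<^sup>2"
  proof (rule quadratic_upper_bound[OF has_derivative_F])
    fix z v assume "z \<in> closed_segment (x k) (x (Suc k))"
    then have "z \<in> S" using segment_in by blast
    have "norm (Jac F z *v v - Jac F (x k) *v v) \<le> opnorm (Jac F z - Jac F (x k)) * norm v"
      by (metis matrix_vector_mult_diff_rdistrib norm_matrix_vector_le_opnorm)
    also have "\<dots> \<le> LF * norm (z - x k) * norm v"
      by (intro mult_right_mono lipschitz(3) \<open>z \<in> S\<close> x_in) simp
    finally show "norm (Jac F z *v v - Jac F (x k) *v v) \<le> LF * norm (z - x k) * norm v" .
  qed
  then show ?thesis
    by (simp add: lin_F_def diff_diff_eq)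
qed

lemma norm_F_diff_le: "norm (F (x (Suc k)) - F (x k)) \<le> MF * dx k"
proof (rule differentiable_bound[where S = "closed_segment (x k) (x (Suc k))" and f' = "\<lambda>z h. Jac F z *v h"])
  show "(F has_derivative (*v) (Jac F z)) (at z within closed_segment (x k) (x (Suc k)))" for z
    by (rule has_derivative_at_withinI[OF has_derivative_F])
  show "onorm ((*v) (Jac F z)) \<le> MF" if "z \<in> closed_segment (x k) (x (Suc k))" for z
    using lipschitz(2)[of z z] segment_in[of k] that by (auto simp: opnorm_def)
qed auto

lemma smooth_descent:
  "f (x (Suc k)) + inner (yt k) (F (x (Suc k))) + \<rho> / 2 * (norm (F (x (Suc k))))\<^sup>2
    \<le> model (x k) (yt k) (x (Suc k)) + ((Lf + LF * dual_bound) / 2 - \<beta> / 2) * (dx k)\<^sup>2"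
proof -
  define l where "l = lin_F F (x (Suc k)) (x k)"
  define d where "d = F (x (Suc k)) - l"
  have F: "F (x (Suc k)) = l + d" by (simp add: d_def)
  \<comment> \<open>Dropping \<open>- \<rho> / 2 * (norm d)\<^sup>2\<close> puts the multiplier at
    the true constraint value \<open>l + d\<close> instead of the linearised \<open>l\<close>; the
    former is what \<open>dual_bound\<close> covers.\<close>
  have "inner (yt k) d + \<rho> / 2 * ((norm (l + d))\<^sup>2 - (norm l)\<^sup>2) \<le> inner (yt k + \<rho> *\<^sub>R (l + d)) d"
    using \<rho> by (simp add: power2_norm_eq_inner inner_add_left inner_add_right inner_commute field_simps)
  also have "\<dots> \<le> norm (yt k + \<rho> *\<^sub>R (l + d)) * norm d"
    by (rule norm_cauchy_schwarz)
  also have "\<dots> \<le> dual_bound * (LF / 2 * (dx k)\<^sup>2)"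
    using norm_multiplier_le[OF x_in[of "Suc k"], of k] lin_F_error[of k] dual_bound_nonneg
    by (intro mult_mono) (auto simp: F[symmetric] d_def l_def)
  finally show ?thesis
    using lin_f_error[of k]
    by (simp add: model_def F inner_add_right l_def[symmetric] field_simps)
qed

text \<open>A rearrangement of \<open>\<beta>\<close> being at least twice \<open>L_const\<close>.
  The share \<open>\<beta> / 4\<close> is reserved to pay for the dual steps; the other summand
  survives as strict decrease.\<close>

lemma step_coefficient: "\<beta> / 4 + \<rho> * MF\<^sup>2 / 2 \<le> \<beta> / 2 - (Lf + LF * dual_bound) / 2"
proof -
  have "2 * (Lf + LF * dual_bound + \<rho> * MF\<^sup>2) \<le> \<beta>"
    using \<beta>_ge by (simp add: L_const_def dual_bound_def)
  then show ?thesis by argo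
qed

lemma primal_descent:
  "gx (Suc k) + f (x (Suc k)) + inner (yt k) (F (x (Suc k))) + \<rho> / 2 * (norm (F (x (Suc k))))\<^sup>2
    \<le> gx k + f (x k) + inner (yt k) (F (x k)) + \<rho> / 2 * (norm (F (x k)))\<^sup>2
      - (\<beta> / 4 + \<rho> * MF\<^sup>2 / 2) * (dx k)\<^sup>2"
proof -
  \<comment> \<open>At the competitor \<open>x k\<close> both linearisations are exact and the
    proximal term vanishes.\<close>
  have "gx (Suc k) + model (x k) (yt k) (x (Suc k)) \<le> gx k + model (x k) (yt k) (x k)"
    using model_minimal[of k "x k"] by (simp add: g_x)
  also have "model (x k) (yt k) (x k) = f (x k) + inner (yt k) (F (x k)) + \<rho> / 2 * (norm (F (x k)))\<^sup>2"
    by (simp add: model_def lin_f_def lin_F_def)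
  finally have "gx (Suc k) + model (x k) (yt k) (x (Suc k))
     \<le> gx k + (f (x k) + inner (yt k) (F (x k)) + \<rho> / 2 * (norm (F (x k)))\<^sup>2)" .
  moreover have "(\<beta> / 4 + \<rho> * MF\<^sup>2 / 2) * (dx k)\<^sup>2 \<le> (\<beta> / 2 - (Lf + LF * dual_bound) / 2) * (dx k)\<^sup>2"
    by (intro mult_right_mono step_coefficient) simp
  ultimately show ?thesis
    using smooth_descent[of k] by (simp add: left_diff_distrib)
qed

section \<open>Dual steps and decrease of the Lyapunov function\<close>

lemma dy_Suc_le: "dy (Suc k) \<le> (1 - \<tau>) * dy k + \<rho> * MF * dx (Suc k)"
proof -
  have "y (Suc (Suc k)) - y (Suc k)
      = (1 - \<tau>) *\<^sub>R (y (Suc k) - y k) + \<rho> *\<^sub>R (F (x (Suc (Suc k))) - F (x (Suc k)))"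
  proof -
    have "y (Suc (Suc k)) - y (Suc k)
        = (yt (Suc k) + \<rho> *\<^sub>R F (x (Suc (Suc k)))) - (yt k + \<rho> *\<^sub>R F (x (Suc k)))"
      by (simp only: y_Suc[symmetric])
    also have "\<dots> = (yt (Suc k) - yt k) + \<rho> *\<^sub>R (F (x (Suc (Suc k))) - F (x (Suc k)))"
      by (simp add: scaleR_diff_right)
    finally show ?thesis
      by (simp only: perturbed_diff)
  qed
  also have "norm \<dots> \<le> (1 - \<tau>) * dy k + \<rho> * norm (F (x (Suc (Suc k))) - F (x (Suc k)))"
    using \<tau> \<rho> norm_triangle_ineq[of "(1 - \<tau>) *\<^sub>R (y (Suc k) - y k)"
        "\<rho> *\<^sub>R (F (x (Suc (Suc k))) - F (x (Suc k)))"] by simp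
  also have "\<dots> \<le> (1 - \<tau>) * dy k + \<rho> * (MF * dx (Suc k))"
    using \<rho> \<tau> norm_F_diff_le by (intro add_mono mult_left_mono) auto
  finally show ?thesis by (simp add: mult.assoc)
qed

text \<open>The squared recursion, with \<open>(1 - \<tau>) * (dy (Suc k))\<^sup>2\<close> moved to
  the right so that the dual part telescopes.\<close>

lemma dy_square_le: "\<tau> * (dy (Suc k))\<^sup>2 \<le> (1 - \<tau>) * ((dy k)\<^sup>2 - (dy (Suc k))\<^sup>2) + \<rho>\<^sup>2 * MF\<^sup>2 / \<tau> * (dx (Suc k))\<^sup>2"
proof -
  have "(dy (Suc k))\<^sup>2 \<le> ((1 - \<tau>) * dy k + \<rho> * MF * dx (Suc k))\<^sup>2"
    by (intro power_mono dy_Suc_le) simp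
  also have "\<dots> \<le> (1 - \<tau>) * (dy k)\<^sup>2 + (\<rho> * MF * dx (Suc k))\<^sup>2 / \<tau>"
    by (intro square_convex_combination_le \<tau>)
  finally show ?thesis
    by (simp add: power_mult_distrib algebra_simps)
qed

lemma multiplier_step:
  "\<rho> *\<^sub>R F (x (Suc k)) = (y (Suc k) - y k) + \<tau> *\<^sub>R (y k - y 0)"
  by (simp add: y_Suc perturbed_def algebra_simps)

text \<open>Separates the two moves of an iteration: the right side keeps the multiplier
  \<open>yt (Suc k)\<close> of the subproblem, to which primal descent applies, and the multiplier
  update costs the term of \<open>dual_step_identity\<close>.\<close>

lemma smooth_part_u_Suc:
  "smooth_part (u (Suc k)) =
    f (x (Suc (Suc k))) + inner (yt (Suc k)) (F (x (Suc (Suc k)))) + \<rho> / 2 * (norm (F (x (Suc (Suc k)))))\<^sup>2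
    - \<tau> * (1 - \<tau>) / (2 * \<rho>) * (norm (y (Suc k) - y 0))\<^sup>2
    + (1 - \<tau>) * (2 - \<tau>) / (2 * \<rho>) * (dy (Suc k))\<^sup>2
    + 2 * (1 - \<tau>)\<^sup>2 / (\<tau> * \<rho>) * (dy (Suc k))\<^sup>2"
proof -
  let ?F = "F (x (Suc (Suc k)))" and ?d = "y (Suc (Suc k)) - y (Suc k)" and ?e = "y (Suc k) - y 0"
  have "inner (yt (Suc (Suc k))) ?F = inner (yt (Suc k)) ?F + (1 - \<tau>) * inner ?d ?F"
    using perturbed_diff[of \<tau> "y 0" "y (Suc (Suc k))" "y (Suc k)"]
    by (metis add_diff_cancel_left' diff_add_cancel inner_add_left inner_scaleR_left add.commute)
  moreover have "?F = (1 / \<rho>) *\<^sub>R (?d + \<tau> *\<^sub>R ?e)"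
    using \<rho> unfolding multiplier_step[symmetric] by simp
  ultimately have "inner (yt (Suc (Suc k))) ?F - \<tau> * (1 - \<tau>) / (2 * \<rho>) * (norm (?e + ?d))\<^sup>2
     = inner (yt (Suc k)) ?F - \<tau> * (1 - \<tau>) / (2 * \<rho>) * (norm ?e)\<^sup>2
       + (1 - \<tau>) * (2 - \<tau>) / (2 * \<rho>) * (norm ?d)\<^sup>2"
    using dual_step_identity[OF \<rho>, of \<tau> ?d ?e] by (simp add: right_diff_distrib)
  then show ?thesis
    by (simp add: smooth_part_def u_def)
qed

text \<open>The dual update costs at most
  \<open>(1 - \<tau>) / \<rho> * (dy (Suc k))\<^sup>2\<close>, while the last Lyapunov term returns
  twice that through \<open>dy_square_le\<close>, at a primal price covered by
  \<open>\<beta> / 4\<close>.\<close>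

lemma lyap_decrease:
  "lyap (Suc k) \<le> lyap k - \<rho> * MF\<^sup>2 / 2 * (dx (Suc k))\<^sup>2 - (1 - \<tau>) / \<rho> * (dy (Suc k))\<^sup>2"
proof -
  have sm: "smooth_part (u k) = f (x (Suc k)) + inner (yt (Suc k)) (F (x (Suc k))) + \<rho> / 2 * (norm (F (x (Suc k))))\<^sup>2
    - \<tau> * (1 - \<tau>) / (2 * \<rho>) * (norm (y (Suc k) - y 0))\<^sup>2 + 2 * (1 - \<tau>)\<^sup>2 / (\<tau> * \<rho>) * (dy k)\<^sup>2"
    by (simp add: smooth_part_def u_def)
  \<comment> \<open>This weight gives
    \<open>(1 - \<tau>) * ((dy k)\<^sup>2 - (dy (Suc k))\<^sup>2)\<close> exactly the coefficient of
    the last Lyapunov term.\<close>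
  have "2 * (1 - \<tau>) / (\<tau> * \<rho>) * (\<tau> * (dy (Suc k))\<^sup>2)
      \<le> 2 * (1 - \<tau>) / (\<tau> * \<rho>) * ((1 - \<tau>) * ((dy k)\<^sup>2 - (dy (Suc k))\<^sup>2) + \<rho>\<^sup>2 * MF\<^sup>2 / \<tau> * (dx (Suc k))\<^sup>2)"
    using \<tau> \<rho> by (intro mult_left_mono dy_square_le) auto
  moreover have "2 * (1 - \<tau>) / (\<tau> * \<rho>) * (\<tau> * (dy (Suc k))\<^sup>2) = 2 * (1 - \<tau>) / \<rho> * (dy (Suc k))\<^sup>2"
    using \<tau> \<rho> by (simp add: field_simps)
  moreover have "2 * (1 - \<tau>) / (\<tau> * \<rho>) * ((1 - \<tau>) * ((dy k)\<^sup>2 - (dy (Suc k))\<^sup>2) + \<rho>\<^sup>2 * MF\<^sup>2 / \<tau> * (dx (Suc k))\<^sup>2)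
     = 2 * (1 - \<tau>)\<^sup>2 / (\<tau> * \<rho>) * (dy k)\<^sup>2 - 2 * (1 - \<tau>)\<^sup>2 / (\<tau> * \<rho>) * (dy (Suc k))\<^sup>2
       + 2 * (1 - \<tau>) * \<rho> * MF\<^sup>2 / \<tau>\<^sup>2 * (dx (Suc k))\<^sup>2"
    using \<tau> \<rho> by (simp add: power2_eq_square field_simps)
  \<comment> \<open>A quarter of the second lower bound on \<open>\<beta>\<close>.\<close>
  moreover have "2 * (1 - \<tau>) * \<rho> * MF\<^sup>2 / \<tau>\<^sup>2 * (dx (Suc k))\<^sup>2 \<le> \<beta> / 4 * (dx (Suc k))\<^sup>2"
  proof (rule mult_right_mono)
    have "8 * (1 - \<tau>) * \<rho> * MF\<^sup>2 / \<tau>\<^sup>2 = 4 * (2 * (1 - \<tau>) * \<rho> * MF\<^sup>2 / \<tau>\<^sup>2)"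
      by simp
    then show "2 * (1 - \<tau>) * \<rho> * MF\<^sup>2 / \<tau>\<^sup>2 \<le> \<beta> / 4"
      using \<beta>_ge by linarith
  qed simp
  moreover have "(1 - \<tau>) * (2 - \<tau>) / (2 * \<rho>) * (dy (Suc k))\<^sup>2 \<le> (1 - \<tau>) / \<rho> * (dy (Suc k))\<^sup>2"
    using \<tau> \<rho> by (intro mult_right_mono) (auto simp: field_simps)
  moreover have "2 * (1 - \<tau>) / \<rho> * (dy (Suc k))\<^sup>2 = (1 - \<tau>) / \<rho> * (dy (Suc k))\<^sup>2 + (1 - \<tau>) / \<rho> * (dy (Suc k))\<^sup>2"
    by (simp add: field_simps)
  ultimately show ?thesis
    using primal_descent[of "Suc k"] unfolding lyap_def smooth_part_u_Suc sm distrib_right by linarith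
qed

text \<open>Both the decrease and the residual control the dual step only up to the factor
  \<open>1 - \<tau>\<close>, which vanishes at \<open>\<tau> = 1\<close>.\<close>

definition step :: "nat \<Rightarrow> real" where
  "step k = dx k + (1 - \<tau>) * dy k"

lemma step_nonneg: "0 \<le> step k"
  using \<tau> by (simp add: step_def)

lemma lyap_decrease_step:
  obtains c where "0 < c" and "\<And>k. lyap (Suc k) \<le> lyap k - c * (step (Suc k))\<^sup>2"
proof
  \<comment> \<open>Half of the coefficients in \<open>lyap_decrease\<close>, the weight
    \<open>1 - \<tau>\<close> apart: squaring the sum costs a factor 2, and
    \<open>(1 - \<tau>)\<^sup>2 \<le> 1 - \<tau>\<close>.\<close>
  let ?c = "min (\<rho> * MF\<^sup>2 / 4) (1 / (2 * \<rho>))"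
  show "0 < ?c" using \<rho> pos_consts by simp
  then have c: "0 \<le> ?c" by simp
  show "lyap (Suc k) \<le> lyap k - ?c * (step (Suc k))\<^sup>2" for k
  proof -
    let ?a = "dx (Suc k)" and ?b = "dy (Suc k)"
    have "(step (Suc k))\<^sup>2 \<le> 2 * ?a\<^sup>2 + 2 * ((1 - \<tau>)\<^sup>2 * ?b\<^sup>2)"
      using sum_squares_ge_zero[of "?a - (1 - \<tau>) * ?b" 0]
      by (simp add: step_def power2_eq_square algebra_simps)
    also have "\<dots> \<le> 2 * ?a\<^sup>2 + 2 * ((1 - \<tau>) * ?b\<^sup>2)"
      using \<tau> by (intro add_left_mono mult_left_mono mult_right_mono) (auto simp: power2_eq_square mult_left_le)
    finally have "?c * (step (Suc k))\<^sup>2 \<le> ?c * (2 * ?a\<^sup>2 + 2 * ((1 - \<tau>) * ?b\<^sup>2))"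
      using c by (rule mult_left_mono)
    also have "\<dots> = ?c * (2 * ?a\<^sup>2) + ?c * (2 * ((1 - \<tau>) * ?b\<^sup>2))"
      by (rule distrib_left)
    also have "\<dots> \<le> \<rho> * MF\<^sup>2 / 4 * (2 * ?a\<^sup>2) + 1 / (2 * \<rho>) * (2 * ((1 - \<tau>) * ?b\<^sup>2))"
      using \<tau> by (intro add_mono mult_right_mono) auto
    also have "\<dots> = \<rho> * MF\<^sup>2 / 2 * ?a\<^sup>2 + (1 - \<tau>) / \<rho> * ?b\<^sup>2"
      by simp
    finally show ?thesis
      using lyap_decrease[of k] by linarith
  qed
qed

lemma lyap_antimono: "m \<le> n \<Longrightarrow> lyap n \<le> lyap m"
proof (rule lift_Suc_antimono_le)
  fix k
  obtain c where c: "0 < c" "\<And>k. lyap (Suc k) \<le> lyap k - c * (step (Suc k))\<^sup>2"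
    using lyap_decrease_step by blast
  have "0 \<le> c * (step (Suc k))\<^sup>2" using c(1) by simp
  with c(2)[of k] show "lyap (Suc k) \<le> lyap k" by linarith
qed

section \<open>Subgradients of the Lyapunov function and the relative error\<close>

definition grad_smooth :: "(real^'n) \<times> (real^'m) \<times> (real^'m) \<Rightarrow> (real^'n) \<times> (real^'m) \<times> (real^'m)" where
  "grad_smooth = (\<lambda>(z, w, w').
     (gradient f z + (perturbed \<tau> (y 0) w + \<rho> *\<^sub>R F z) v* Jac F z,
      (1 - \<tau>) *\<^sub>R F z - (\<tau> * (1 - \<tau>) / \<rho>) *\<^sub>R (w - y 0) + (4 * (1 - \<tau>)\<^sup>2 / (\<tau> * \<rho>)) *\<^sub>R (w - w'),
      - (4 * (1 - \<tau>)\<^sup>2 / (\<tau> * \<rho>)) *\<^sub>R (w - w')))"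

text \<open>The optimality condition of the subproblem solved for the part due to \<open>g\<close>:
  a subgradient at \<open>x (Suc k)\<close> built from derivatives at \<open>x k\<close>.\<close>

definition subgrad :: "nat \<Rightarrow> real^'n" where
  "subgrad k = - (gradient f (x k)
     + (yt k + \<rho> *\<^sub>R lin_F F (x (Suc k)) (x k)) v* Jac F (x k) + \<beta> *\<^sub>R (x (Suc k) - x k))"

definition residual :: "nat \<Rightarrow> (real^'n) \<times> (real^'m) \<times> (real^'m)" where
  "residual k = (subgrad k, 0) + grad_smooth (u k)"

lemma GDERIV_model:
  "GDERIV (model a w) z :> gradient f a + (w + \<rho> *\<^sub>R lin_F F z a) v* Jac F a + \<beta> *\<^sub>R (z - a)"
proof -
  have J: "((\<lambda>z. Jac F a *v (z - a)) has_derivative (\<lambda>h. Jac F a *v h)) (at z)"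
    by (rule bounded_linear.has_derivative[OF matrix_vector_mul_bounded_linear, of _ "\<lambda>h. h", simplified])
      (auto intro!: derivative_eq_intros)
  show ?thesis
    unfolding gderiv_def model_def[abs_def] lin_f_def lin_F_def power2_norm_eq_inner
    by (rule has_derivative_eq_rhs, (rule derivative_intros J)+)
      (auto simp: fun_eq_iff inner_add_left inner_add_right dot_lmul_matrix inner_vector_matrix
        inner_diff_left inner_diff_right inner_commute field_simps)
qed

lemma frechet_subgradient_g: "frechet_subgradient g (x (Suc k)) (subgrad k)"
  unfolding subgrad_def
  by (rule frechet_subgradient_minimizer[OF GDERIV_model model_minimal g_x])

lemma GDERIV_smooth_part: "GDERIV smooth_part v :> grad_smooth v"
proof -
  obtain z w w' where v: "v = (z, w, w')" by (cases v)
  have f: "((\<lambda>v. f (fst v)) has_derivative (\<lambda>h. inner (fst h) (gradient f z))) (at v)"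
    using has_derivative_compose[OF has_derivative_fst[OF has_derivative_ident] has_derivative_f, of v UNIV]
    by (simp add: v)
  have F: "((\<lambda>v. F (fst v)) has_derivative (\<lambda>h. Jac F z *v fst h)) (at v)"
    using has_derivative_compose[OF has_derivative_fst[OF has_derivative_ident] has_derivative_F, of v UNIV]
    by (simp add: v)
  have "smooth_part = (\<lambda>v. f (fst v) + inner (\<tau> *\<^sub>R y 0 + (1 - \<tau>) *\<^sub>R fst (snd v)) (F (fst v))
     + \<rho> / 2 * inner (F (fst v)) (F (fst v))
     - \<tau> * (1 - \<tau>) / (2 * \<rho>) * inner (fst (snd v) - y 0) (fst (snd v) - y 0)
     + 2 * (1 - \<tau>)\<^sup>2 / (\<tau> * \<rho>) * inner (fst (snd v) - snd (snd v)) (fst (snd v) - snd (snd v)))"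
    by (auto simp: smooth_part_def perturbed_def power2_norm_eq_inner)
  then show ?thesis
    unfolding gderiv_def
    using \<tau> \<rho>
    by (simp only:) (rule has_derivative_eq_rhs, (rule derivative_intros f F)+,
      auto simp: v grad_smooth_def perturbed_def fun_eq_iff inner_add_left inner_add_right
        inner_diff_left inner_diff_right dot_lmul_matrix inner_vector_matrix inner_commute power2_eq_square field_simps)
qed

lemma residual_in_subdiff: "residual k \<in> limiting_subdiff (lyapunov f g F \<tau> \<rho> (y 0)) (u k)"
proof -
  have "frechet_subgradient (\<lambda>v. g (fst v) + ereal (smooth_part v)) (u k) (residual k)"
    unfolding residual_def
    by (rule frechet_subgradient_fst_plus_smooth[OF _ GDERIV_smooth_part])
      (simp_all add: u_def frechet_subgradient_g g_x)
  then show ?thesis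
    using lyapunov_u[of k] by (intro frechet_subgradient_in_limiting_subdiff) (simp_all add: lyapunov_eq[abs_def])
qed

text \<open>The subgradient of \<open>g\<close>, with derivatives at \<open>x k\<close>, meets the
  gradient of \<open>smooth_part\<close> at \<open>x (Suc k)\<close>; what survives are terms linear
  in the primal or the weighted dual step.\<close>

lemma norm_residual_le:
  "norm (residual k) \<le> (Lf + \<beta> + LF * dual_bound + MF + 2 * \<rho> * MF\<^sup>2 + 1 / \<rho> + 8 / (\<tau> * \<rho>)) * step k"
proof -
  \<comment> \<open>A pivot bounded by \<open>dual_bound\<close>: the multipliers in the two
    gradients differ from \<open>m\<close> by \<open>(1 - \<tau>)\<close> times the dual step and by
    \<open>\<rho> *\<^sub>R d\<close>.\<close>
  define m where "m = yt k + \<rho> *\<^sub>R F (x (Suc k))"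
  define d where "d = F (x (Suc k)) - lin_F F (x (Suc k)) (x k)"
  define c where "c = 4 * (1 - \<tau>)\<^sup>2 / (\<tau> * \<rho>)"
  let ?J = "Jac F (x k)" and ?J' = "Jac F (x (Suc k))" and ?dx = "x (Suc k) - x k" and ?dy = "y (Suc k) - y k"
  let ?D = "(1 - \<tau>) * dy k"
  define r1 where "r1 = gradient f (x (Suc k)) - gradient f (x k) - \<beta> *\<^sub>R ?dx
      + (m v* (?J' - ?J) + ((1 - \<tau>) *\<^sub>R ?dy) v* ?J' + (\<rho> *\<^sub>R d) v* ?J)"
  define r2 where "r2 = ((1 - \<tau>)\<^sup>2 / \<rho> + c) *\<^sub>R ?dy"
  have res: "residual k = (r1, r2, - c *\<^sub>R ?dy)"
  proof -
    have e1: "yt (Suc k) + \<rho> *\<^sub>R F (x (Suc k)) = m + (1 - \<tau>) *\<^sub>R ?dy"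
      using perturbed_diff[of \<tau> "y 0" "y (Suc k)" "y k"] by (simp add: m_def algebra_simps)
    have e2: "yt k + \<rho> *\<^sub>R lin_F F (x (Suc k)) (x k) = m - \<rho> *\<^sub>R d"
      by (simp add: m_def d_def algebra_simps)
    \<comment> \<open>The multiplier update expresses \<open>F\<close> through dual differences, and
      the offset from \<open>y 0\<close> cancels.\<close>
    have e3: "(1 - \<tau>) *\<^sub>R F (x (Suc k)) - (\<tau> * (1 - \<tau>) / \<rho>) *\<^sub>R (y (Suc k) - y 0)
       = ((1 - \<tau>)\<^sup>2 / \<rho>) *\<^sub>R ?dy"
    proof -
      have "F (x (Suc k)) = (1 / \<rho>) *\<^sub>R (?dy + \<tau> *\<^sub>R (y k - y 0))"
        using \<rho> unfolding multiplier_step[symmetric] by simp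
      moreover have "(1 - \<tau>) *\<^sub>R (1 / \<rho>) *\<^sub>R a - (\<tau> * (1 - \<tau>) / \<rho>) *\<^sub>R b = ((1 - \<tau>) / \<rho>) *\<^sub>R (a - \<tau> *\<^sub>R b)"
        for a b :: "real^'m"
        by (simp add: scaleR_diff_right mult.commute)
      ultimately have "(1 - \<tau>) *\<^sub>R F (x (Suc k)) - (\<tau> * (1 - \<tau>) / \<rho>) *\<^sub>R (y (Suc k) - y 0)
        = ((1 - \<tau>) / \<rho>) *\<^sub>R (?dy + \<tau> *\<^sub>R (y k - y 0) - \<tau> *\<^sub>R (y (Suc k) - y 0))"
        by (simp only:)
      also have "?dy + \<tau> *\<^sub>R (y k - y 0) - \<tau> *\<^sub>R (y (Suc k) - y 0) = (1 - \<tau>) *\<^sub>R ?dy"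
        by (simp add: algebra_simps)
      finally show ?thesis
        by (simp add: power2_eq_square)
    qed
    have "subgrad k + (gradient f (x (Suc k)) + (yt (Suc k) + \<rho> *\<^sub>R F (x (Suc k))) v* ?J') = r1"
      unfolding subgrad_def r1_def e1 e2
      by (simp add: vector_matrix_left_distrib vector_matrix_mult_diff_distrib vector_matrix_mult_diff_rdistrib)
    then show ?thesis
      using e3 by (simp add: residual_def grad_smooth_def u_def r2_def c_def scaleR_add_left)
  qed
  have D: "0 \<le> ?D" using \<tau> by simp
  \<comment> \<open>A bound linear in \<open>dx k\<close> is wanted here, whereas
    \<open>lin_F_error\<close> is quadratic.\<close>
  have "norm d \<le> 2 * MF * dx k"
  proof -
    have "norm d \<le> norm (F (x (Suc k)) - F (x k)) + norm (?J *v ?dx)"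
      using norm_triangle_ineq4[of "F (x (Suc k)) - F (x k)" "?J *v ?dx"]
      by (simp add: d_def lin_F_def diff_diff_eq)
    also have "\<dots> \<le> MF * dx k + MF * dx k"
      using norm_matrix_vector_le_opnorm[of ?J ?dx] lipschitz(2)[OF x_in x_in, of k]
      by (intro add_mono norm_F_diff_le) (meson mult_right_mono norm_ge_zero order_trans)
    finally show ?thesis by simp
  qed
  then have "norm ((\<rho> *\<^sub>R d) v* ?J) \<le> MF * (\<rho> * (2 * MF * dx k))"
    using norm_vector_matrix_le_opnorm[of "\<rho> *\<^sub>R d" ?J] lipschitz(2)[OF x_in x_in, of k] \<rho> pos_consts
    by (elim order_trans) (auto intro!: mult_mono)
  moreover have "norm (((1 - \<tau>) *\<^sub>R ?dy) v* ?J') \<le> MF * ?D"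
    using norm_vector_matrix_le_opnorm[of "(1 - \<tau>) *\<^sub>R ?dy" ?J'] lipschitz(2)[OF x_in x_in, of "Suc k"] \<tau>
    by (elim order_trans) (auto intro!: mult_right_mono)
  moreover have "norm (m v* (?J' - ?J)) \<le> LF * dx k * dual_bound"
    using norm_vector_matrix_le_opnorm[of m "?J' - ?J"] lipschitz(3)[OF x_in x_in, of "Suc k" k]
      norm_multiplier_le[OF x_in[of "Suc k"], of k] pos_consts
    by (elim order_trans) (auto intro!: mult_mono simp: m_def)
  moreover have "norm (gradient f (x (Suc k)) - gradient f (x k)) \<le> Lf * dx k"
    by (rule lipschitz(1)[OF x_in x_in])
  moreover have "norm r1 \<le> norm (gradient f (x (Suc k)) - gradient f (x k)) + norm (\<beta> *\<^sub>R ?dx)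
      + (norm (m v* (?J' - ?J)) + norm (((1 - \<tau>) *\<^sub>R ?dy) v* ?J') + norm ((\<rho> *\<^sub>R d) v* ?J))"
    unfolding r1_def by (intro norm_triangle_mono norm_triangle_ineq4 order_refl)
  moreover have "norm (\<beta> *\<^sub>R ?dx) = \<beta> * dx k"
    using \<beta> by simp
  ultimately have "norm r1 \<le> Lf * dx k + \<beta> * dx k + (LF * dx k * dual_bound + MF * ?D + MF * (\<rho> * (2 * MF * dx k)))"
    by linarith
  also have "\<dots> = (Lf + \<beta> + LF * dual_bound + 2 * \<rho> * MF\<^sup>2) * dx k + MF * ?D"
    by (simp add: algebra_simps power2_eq_square)
  finally have r1: "norm r1 \<le> (Lf + \<beta> + LF * dual_bound + 2 * \<rho> * MF\<^sup>2) * dx k + MF * ?D" .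
  have c: "0 \<le> c" "c * dy k \<le> 4 / (\<tau> * \<rho>) * ?D"
  proof -
    show "0 \<le> c" using \<tau> \<rho> by (simp add: c_def)
    have "(1 - \<tau>)\<^sup>2 * dy k \<le> ?D"
      using \<tau> by (intro mult_right_mono) (auto simp: power2_eq_square mult_left_le)
    then have "4 / (\<tau> * \<rho>) * ((1 - \<tau>)\<^sup>2 * dy k) \<le> 4 / (\<tau> * \<rho>) * ?D"
      using \<tau> \<rho> by (intro mult_left_mono) auto
    then show "c * dy k \<le> 4 / (\<tau> * \<rho>) * ?D" by (simp add: c_def)
  qed
  have "(1 - \<tau>)\<^sup>2 / \<rho> * dy k \<le> 1 / \<rho> * ?D"
    using \<tau> \<rho> by (auto simp: power2_eq_square mult_left_le divide_right_mono mult_right_mono)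
  then have r2: "norm r2 \<le> (1 / \<rho> + 4 / (\<tau> * \<rho>)) * ?D"
    using c \<rho> \<tau> by (simp add: r2_def distrib_right)
  have "norm (residual k) \<le> norm r1 + (norm r2 + norm (- c *\<^sub>R ?dy))"
    unfolding res using norm_Pair_le[of r1 "(r2, - c *\<^sub>R ?dy)"] norm_Pair_le[of r2 "- c *\<^sub>R ?dy"] by linarith
  also have "\<dots> \<le> (Lf + \<beta> + LF * dual_bound + 2 * \<rho> * MF\<^sup>2) * dx k + (MF + 1 / \<rho> + 8 / (\<tau> * \<rho>)) * ?D"
  proof -
    have "norm (- c *\<^sub>R ?dy) \<le> 4 / (\<tau> * \<rho>) * ?D"
      using c by simp
    from add_mono[OF r1 add_mono[OF r2 this]] show ?thesis
      by (rule order_trans) (rule eq_refl, use \<tau> \<rho> in \<open>simp add: field_simps\<close>)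
  qed
  \<comment> \<open>Both coefficients are enlarged to a common one, so that \<open>step k\<close>
    factors out.\<close>
  also have "\<dots> \<le> (Lf + \<beta> + LF * dual_bound + MF + 2 * \<rho> * MF\<^sup>2 + 1 / \<rho> + 8 / (\<tau> * \<rho>)) * dx k
      + (Lf + \<beta> + LF * dual_bound + MF + 2 * \<rho> * MF\<^sup>2 + 1 / \<rho> + 8 / (\<tau> * \<rho>)) * ?D"
  proof -
    have "0 \<le> Lf + \<beta> + LF * dual_bound + 2 * \<rho> * MF\<^sup>2" "0 \<le> MF + 1 / \<rho> + 8 / (\<tau> * \<rho>)"
      using pos_consts \<beta> \<rho> \<tau> dual_bound_nonneg by simp_all
    then have a: "Lf + \<beta> + LF * dual_bound + 2 * \<rho> * MF\<^sup>2
          \<le> Lf + \<beta> + LF * dual_bound + MF + 2 * \<rho> * MF\<^sup>2 + 1 / \<rho> + 8 / (\<tau> * \<rho>)"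
        and b: "MF + 1 / \<rho> + 8 / (\<tau> * \<rho>)
          \<le> Lf + \<beta> + LF * dual_bound + MF + 2 * \<rho> * MF\<^sup>2 + 1 / \<rho> + 8 / (\<tau> * \<rho>)"
      by linarith+
    show ?thesis
      by (rule add_mono[OF mult_right_mono[OF a norm_ge_zero] mult_right_mono[OF b D]])
  qed
  finally show ?thesis
    by (simp add: step_def distrib_left)
qed

section \<open>Limit points and the limiting Lyapunov value\<close>

lemma model_tendsto:
  assumes a: "a \<longlonglongrightarrow> z0" and w: "w \<longlonglongrightarrow> w0" and z: "z \<longlonglongrightarrow> z0"
  shows "(\<lambda>n. model (a n) (w n) (z n)) \<longlonglongrightarrow> f z0 + inner w0 (F z0) + \<rho> / 2 * (norm (F z0))\<^sup>2"
proof -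
  have "(\<lambda>n. lin_f f (z n) (a n)) \<longlonglongrightarrow> f z0 + inner (gradient f z0) (z0 - z0)"
    unfolding lin_f_def
    by (intro tendsto_intros isCont_tendsto_compose[OF isCont_f] isCont_tendsto_compose[OF isCont_gradient] a z)
  then have f: "(\<lambda>n. lin_f f (z n) (a n)) \<longlonglongrightarrow> f z0" by simp
  have "(\<lambda>n. lin_F F (z n) (a n)) \<longlonglongrightarrow> F z0 + Jac F z0 *v (z0 - z0)"
    unfolding lin_F_def
    by (intro tendsto_add tendsto_diff tendsto_matrix_vector_mult isCont_tendsto_compose[OF isCont_F]
        isCont_tendsto_compose[OF isCont_Jac] a z)
  then have F: "(\<lambda>n. lin_F F (z n) (a n)) \<longlonglongrightarrow> F z0" by simp
  have "(\<lambda>n. model (a n) (w n) (z n))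
      \<longlonglongrightarrow> f z0 + inner w0 (F z0) + \<rho> / 2 * (norm (F z0))\<^sup>2 + \<beta> / 2 * (norm (z0 - z0))\<^sup>2"
    unfolding model_def by (intro tendsto_intros f F a w z)
  then show ?thesis by simp
qed

lemma isCont_smooth_part: "isCont smooth_part v"
  using GDERIV_smooth_part has_derivative_continuous unfolding gderiv_def by blast

lemma bounded_range_u: "bounded (range u)"
proof (rule bounded_subset)
  let ?B = "cball 0 (dual_radius F S \<tau> \<rho> (y 0)) :: (real^'m) set"
  show "bounded (S \<times> ?B \<times> ?B)"
    by (intro bounded_Times compact_imp_bounded compact_S compact_cball)
  show "range u \<subseteq> S \<times> ?B \<times> ?B"
    using x_in norm_y_le by (auto simp: u_def)
qed

text \<open>Lower semicontinuity and monotonicity bound the value at \<open>l\<close> by every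
  \<open>lyap n\<close>, so \<open>g\<close> is finite there and \<open>lyap\<close> converges. For
  the reverse inequality \<open>fst l\<close> competes in the subproblems along \<open>r\<close>:
  both model values tend to the same limit.\<close>

lemma lyap_subseq_limit:
  assumes lsc: "lsc (lyapunov f g F \<tau> \<rho> (y 0))" and r: "strict_mono r" and l: "(u \<circ> r) \<longlonglongrightarrow> l"
  obtains \<gamma> where "g (fst l) = ereal \<gamma>" and "lyap \<longlonglongrightarrow> \<gamma> + smooth_part l"
proof -
  have ur: "(\<lambda>n. u (r n)) \<longlonglongrightarrow> l" using l by (simp add: o_def)
  have le: "lyapunov f g F \<tau> \<rho> (y 0) l \<le> ereal (lyap n)" for n
  proof (rule lsc_le_limit[OF lsc LIMSEQ_ignore_initial_segment[OF ur, of n]])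
    show "(\<lambda>_. lyap n) \<longlonglongrightarrow> lyap n" by simp
    fix j
    have "n \<le> r (j + n)"
      using seq_suble[OF r, of "j + n"] by linarith
    then show "lyapunov f g F \<tau> \<rho> (y 0) (u (r (j + n))) \<le> ereal (lyap n)"
      using lyap_antimono by (simp add: lyapunov_u)
  qed
  obtain \<gamma> where \<gamma>: "g (fst l) = ereal \<gamma>"
    using le[of 0] g_not_minf[of "fst l"] by (cases "g (fst l)") (auto simp: lyapunov_eq)
  have low: "\<gamma> + smooth_part l \<le> lyap n" for n
    using le[of n] \<gamma> by (simp add: lyapunov_eq)
  obtain q where q: "lyap \<longlonglongrightarrow> q"
  proof (rule decseq_convergent[of lyap "\<gamma> + smooth_part l"])
    show "decseq lyap" unfolding decseq_def using lyap_antimono by blast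
    show "\<forall>i. \<gamma> + smooth_part l \<le> lyap i" using low by blast
  qed blast
  obtain c where c: "0 < c" "\<And>k. lyap (Suc k) \<le> lyap k - c * (step (Suc k))\<^sup>2"
    using lyap_decrease_step by blast
  have "(\<lambda>k. (step (Suc k))\<^sup>2) \<longlonglongrightarrow> 0"
  proof (rule Lim_null_comparison)
    show "\<forall>\<^sub>F k in sequentially. norm ((step (Suc k))\<^sup>2) \<le> (lyap k - lyap (Suc k)) / c"
    proof (intro always_eventually allI)
      show "norm ((step (Suc k))\<^sup>2) \<le> (lyap k - lyap (Suc k)) / c" for k
        using c(1) c(2)[of k] by (simp add: pos_le_divide_eq mult.commute)
    qed
    have "(\<lambda>k. (lyap k - lyap (Suc k)) / c) \<longlonglongrightarrow> (q - q) / c"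
      using c(1) by (intro tendsto_intros q LIMSEQ_Suc) auto
    then show "(\<lambda>k. (lyap k - lyap (Suc k)) / c) \<longlonglongrightarrow> 0" by simp
  qed
  from tendsto_real_sqrt[OF this] have "(\<lambda>k. step (Suc k)) \<longlonglongrightarrow> 0"
    by (simp add: step_nonneg)
  then have "(\<lambda>n. step (r n)) \<longlonglongrightarrow> 0"
    using LIMSEQ_subseq_LIMSEQ[OF LIMSEQ_imp_Suc r] by (simp add: o_def)
  \<comment> \<open>\<open>u (r n)\<close> locates \<open>x (Suc (r n))\<close>, but the subproblem
    is centred at \<open>x (r n)\<close>; vanishing steps give both the same limit.\<close>
  then have dx0: "(\<lambda>n. x (Suc (r n)) - x (r n)) \<longlonglongrightarrow> 0"
    by (rule Lim_null_comparison[rotated]) (use \<tau> in \<open>simp add: step_def\<close>)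
  have xS: "(\<lambda>n. x (Suc (r n))) \<longlonglongrightarrow> fst l"
    using tendsto_fst[OF ur] by (simp add: u_def)
  have xr: "(\<lambda>n. x (r n)) \<longlonglongrightarrow> fst l"
    using tendsto_diff[OF xS dx0] by simp
  \<comment> \<open>The third component of \<open>u\<close> is the multiplier with which
    \<open>x (Suc (r n))\<close> was computed.\<close>
  have "(\<lambda>n. y (r n)) \<longlonglongrightarrow> snd (snd l)"
    using tendsto_snd[OF tendsto_snd[OF ur]] by (simp add: u_def)
  then have ytr: "(\<lambda>n. yt (r n)) \<longlonglongrightarrow> perturbed \<tau> (y 0) (snd (snd l))"
    unfolding perturbed_def by (intro tendsto_intros)
  let ?M = "f (fst l) + inner (perturbed \<tau> (y 0) (snd (snd l))) (F (fst l)) + \<rho> / 2 * (norm (F (fst l)))\<^sup>2"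
  have "(\<lambda>n. \<gamma> + model (x (r n)) (yt (r n)) (fst l) - model (x (r n)) (yt (r n)) (x (Suc (r n))) + smooth_part (u (r n)))
      \<longlonglongrightarrow> \<gamma> + ?M - ?M + smooth_part l"
    by (intro tendsto_add tendsto_diff model_tendsto tendsto_const xr ytr xS
        isCont_tendsto_compose[OF isCont_smooth_part] ur)
  moreover have "lyap (r n) \<le> \<gamma> + model (x (r n)) (yt (r n)) (fst l)
      - model (x (r n)) (yt (r n)) (x (Suc (r n))) + smooth_part (u (r n))" for n
    using model_minimal[of "r n" "fst l"] by (simp add: lyap_def \<gamma> g_x)
  moreover have "(\<lambda>n. lyap (r n)) \<longlonglongrightarrow> q"
    using LIMSEQ_subseq_LIMSEQ[OF q r] by (simp add: o_def)
  ultimately have "q \<le> \<gamma> + ?M - ?M + smooth_part l"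
    by (intro LIMSEQ_le) auto
  moreover have "\<gamma> + smooth_part l \<le> q"
    using low by (intro LIMSEQ_le_const[OF q]) auto
  ultimately have "q = \<gamma> + smooth_part l" by simp
  with that \<gamma> q show thesis by blast
qed

section \<open>Summability of the steps and optimality of the limit\<close>

lemma summable_increments:
  assumes KL: "KL_on (lyapunov f g F \<tau> \<rho> (y 0)) (limit_points u)"
  shows "summable dx" and "summable dy"
proof -
  let ?\<Phi> = "lyapunov f g F \<tau> \<rho> (y 0)"
  have lsc: "lsc ?\<Phi>" using KL by (simp add: KL_on_def)
  obtain l r where "strict_mono r" "(u \<circ> r) \<longlonglongrightarrow> l"
    using bounded_imp_convergent_subsequence[OF bounded_range_u] by blast
  \<comment> \<open>One limit point yields the limit \<open>q\<close> of \<open>lyap\<close>; by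
    uniqueness of limits the Lyapunov function takes this value at all of them.\<close>
  from lyap_subseq_limit[OF lsc this] obtain q where q: "lyap \<longlonglongrightarrow> q" by blast
  have "?\<Phi> l = ereal q" if "l \<in> limit_points u" for l
  proof -
    from that obtain r where r: "strict_mono r" "(u \<circ> r) \<longlonglongrightarrow> l"
      unfolding limit_points_def by blast
    obtain \<gamma> where \<gamma>: "g (fst l) = ereal \<gamma>" "lyap \<longlonglongrightarrow> \<gamma> + smooth_part l"
      using lyap_subseq_limit[OF lsc r] by blast
    with q have "q = \<gamma> + smooth_part l" using LIMSEQ_unique by blast
    with \<gamma>(1) show ?thesis by (simp add: lyapunov_eq)
  qed
  moreover obtain c where "0 < c" "\<And>k. lyap (Suc k) \<le> lyap k - c * (step (Suc k))\<^sup>2"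
    using lyap_decrease_step by blast
  ultimately have "summable step"
    using KL_on_summable[OF KL bounded_range_u lyapunov_u _ q step_nonneg _ _ residual_in_subdiff norm_residual_le]
    by blast
  then show dx: "summable dx"
    by (rule summable_comparison_test'[where N = 0]) (use \<tau> in \<open>simp add: step_def\<close>)
  show "summable dy"
  proof (rule summable_nonneg_contraction)
    show "dy (Suc k) \<le> (1 - \<tau>) * dy k + \<rho> * MF * dx (Suc k)" for k
      by (rule dy_Suc_le)
    show "summable (\<lambda>k. \<rho> * MF * dx (Suc k))"
      using summable_ignore_initial_segment[OF dx, of 1] by (intro summable_mult) simp
    show "0 \<le> \<rho> * MF * dx (Suc k)" for k
      using \<rho> pos_consts by simp
  qed (use \<tau> in auto)
qed

lemma first_order_optimal_limit:
  assumes lsc: "lsc (lyapunov f g F \<tau> \<rho> (y 0))" and xs: "x \<longlonglongrightarrow> xs" and ys: "y \<longlonglongrightarrow> ys"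
  shows "first_order_optimal f g F (\<tau> / \<rho> * norm (ys - y 0)) xs ys"
proof -
  have u: "u \<longlonglongrightarrow> (xs, ys, ys)"
    unfolding u_def[abs_def] by (intro tendsto_Pair LIMSEQ_Suc xs ys)
  obtain \<gamma> where \<gamma>: "g xs = ereal \<gamma>" "lyap \<longlonglongrightarrow> \<gamma> + smooth_part (xs, ys, ys)"
    using lyap_subseq_limit[OF lsc strict_mono_id, of "(xs, ys, ys)"] u by (auto simp: id_def o_def)
  \<comment> \<open>Subtracting the continuous part isolates the convergence of the \<open>g\<close>
    values that \<open>limiting_subdiff_closed\<close> requires.\<close>
  have "(\<lambda>k. lyap k - smooth_part (u k)) \<longlonglongrightarrow> (\<gamma> + smooth_part (xs, ys, ys)) - smooth_part (xs, ys, ys)"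
    by (intro tendsto_diff \<gamma>(2) isCont_tendsto_compose[OF isCont_smooth_part] u)
  then have gx: "(\<lambda>k. gx (Suc k)) \<longlonglongrightarrow> \<gamma>"
    by (simp add: lyap_def)
  have yt: "(\<lambda>k. yt k) \<longlonglongrightarrow> perturbed \<tau> (y 0) ys"
    unfolding perturbed_def by (intro tendsto_intros ys)
  have "(\<lambda>k. y (Suc k)) \<longlonglongrightarrow> perturbed \<tau> (y 0) ys + \<rho> *\<^sub>R F xs"
    unfolding y_Suc by (intro tendsto_intros yt isCont_tendsto_compose[OF isCont_F] LIMSEQ_Suc xs)
  \<comment> \<open>This fixed-point equation serves twice: it turns the limiting multiplier into
    \<open>ys\<close>, and it determines \<open>F xs\<close>.\<close>
  with LIMSEQ_Suc[OF ys] have ys_eq: "ys = perturbed \<tau> (y 0) ys + \<rho> *\<^sub>R F xs"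
    using LIMSEQ_unique by blast
  have "(\<lambda>k. lin_F F (x (Suc k)) (x k)) \<longlonglongrightarrow> F xs + Jac F xs *v (xs - xs)"
    unfolding lin_F_def
    by (intro tendsto_add tendsto_diff tendsto_matrix_vector_mult isCont_tendsto_compose[OF isCont_F]
        isCont_tendsto_compose[OF isCont_Jac] LIMSEQ_Suc xs)
  then have lin: "(\<lambda>k. lin_F F (x (Suc k)) (x k)) \<longlonglongrightarrow> F xs" by simp
  have lim: "subgrad \<longlonglongrightarrow> - (gradient f xs + (perturbed \<tau> (y 0) ys + \<rho> *\<^sub>R F xs) v* Jac F xs + \<beta> *\<^sub>R (xs - xs))"
    unfolding subgrad_def[abs_def]
    by (intro tendsto_minus tendsto_add tendsto_scaleR tendsto_const tendsto_diff tendsto_vector_matrix_mult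
        isCont_tendsto_compose[OF isCont_gradient] isCont_tendsto_compose[OF isCont_Jac] LIMSEQ_Suc xs yt lin)
  have "subgrad \<longlonglongrightarrow> - gradient f xs - ys v* Jac F xs"
    using lim unfolding ys_eq[symmetric] by simp
  from limiting_subdiff_closed[OF frechet_subgradient_g g_x \<gamma>(1) LIMSEQ_Suc[OF xs] this gx]
  have "- gradient f xs - transpose (Jac F xs) *v ys \<in> limiting_subdiff g xs"
    by simp
  from set_dist_le[OF this, of "- gradient f xs - transpose (Jac F xs) *v ys"]
  \<comment> \<open>Stationarity holds exactly in the limit; the tolerance measures infeasibility
    alone.\<close>
  have "set_dist (- gradient f xs - transpose (Jac F xs) *v ys) (limiting_subdiff g xs) \<le> 0"
    by (simp only: dist_self zero_ereal_def)
  also have "0 \<le> ereal (\<tau> / \<rho> * norm (ys - y 0))"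
    using \<tau> \<rho> by simp
  finally have "set_dist (- gradient f xs - transpose (Jac F xs) *v ys) (limiting_subdiff g xs)
      \<le> ereal (\<tau> / \<rho> * norm (ys - y 0))" .
  moreover have "norm (F xs) = \<tau> / \<rho> * norm (ys - y 0)"
  proof -
    have "\<rho> *\<^sub>R F xs = ys - perturbed \<tau> (y 0) ys"
      using arg_cong[OF ys_eq, of "\<lambda>a. a - perturbed \<tau> (y 0) ys"] by simp
    also have "\<dots> = \<tau> *\<^sub>R (ys - y 0)"
      by (simp add: perturbed_def algebra_simps)
    finally have "norm (\<rho> *\<^sub>R F xs) = norm (\<tau> *\<^sub>R (ys - y 0))"
      by (rule arg_cong)
    then have "\<rho> * norm (F xs) = \<tau> * norm (ys - y 0)"
      using \<tau> \<rho> by simp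
    then show ?thesis using \<rho> by (simp add: field_simps)
  qed
  ultimately show ?thesis
    by (simp add: first_order_optimal_def)
qed

end

theorem lemma11:
  fixes f :: "real^'n \<Rightarrow> real" and g :: "real^'n \<Rightarrow> ereal" and F :: "real^'n \<Rightarrow> real^'m"
    and S :: "(real^'n) set"
    and \<tau> \<rho> \<beta> Mf MF Lf LF \<sigma> :: real
    and x :: "nat \<Rightarrow> real^'n" and y :: "nat \<Rightarrow> real^'m"
  assumes "smooth_fun f" and "smooth_map F" and "proper_fun g" and "lsc g"
    and "0 < \<tau>" and "\<tau> \<le> 1" and "0 < \<rho>" and "0 < \<beta>"
    and "LIPAL f g F \<tau> \<rho> \<beta> x y"
    and "compact S" and "\<And>k. x k \<in> S"
    and "\<And>k. closed_segment (x k) (x (Suc k)) \<subseteq> S"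
    and "regularity_assumption f g F S Mf MF Lf LF \<sigma>"
    and "\<beta> \<ge> max (2 * L_const F S Lf LF MF \<tau> \<rho> (y 0)) (8 * (1 - \<tau>) * \<rho> * MF\<^sup>2 / \<tau>\<^sup>2)"
    and "KL_on (lyapunov f g F \<tau> \<rho> (y 0)) (limit_points (\<lambda>k. (x (Suc k), y (Suc k), y k)))"
  shows "summable (\<lambda>k. norm (x (Suc k) - x k) + norm (y (Suc k) - y k)) \<and>
         (\<exists>xs ys. (\<lambda>k. (x k, y k)) \<longlonglongrightarrow> (xs, ys) \<and>
            first_order_optimal f g F (\<tau> / \<rho> * norm (ys - y 0)) xs ys)"
proof -
  interpret lipal_run f g F S \<tau> \<rho> \<beta> Mf MF Lf LF \<sigma> x y
    using assms by unfold_locales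
  have KL: "KL_on (lyapunov f g F \<tau> \<rho> (y 0)) (limit_points u)"
    using assms(15) by (simp add: u_def[abs_def])
  obtain xs where xs: "x \<longlonglongrightarrow> xs"
    using summable_increments(1)[OF KL] by (rule summable_increments_imp_convergent)
  obtain ys where ys: "y \<longlonglongrightarrow> ys"
    using summable_increments(2)[OF KL] by (rule summable_increments_imp_convergent)
  have "lsc (lyapunov f g F \<tau> \<rho> (y 0))"
    using KL by (simp add: KL_on_def)
  from first_order_optimal_limit[OF this xs ys] show ?thesis
    using summable_add[OF summable_increments[OF KL]] tendsto_Pair[OF xs ys] by blast
qed

end
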